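(* Let $A,B\in\mathrm{SL}_2\mathbb{Z}_{\ge0}$ be noncommuting and such that the pair $A,B$ is well oriented, and assume $\mathrm{tr}(A)<\mathrm{tr}(B)$ and $\mathrm{tr}(AB)>\mathrm{tr}(B^2)$. If $\mathrm{tr}((AB)^3)>\mathrm{tr}((AB^2)^2)$, then $ab$ is the only optimal word; otherwise $ab^2$ is the only optimal word.
   Context: $\mathrm{SL}_2\mathbb{Z}_{\ge0}$ denotes the $2\times2$ matrices with nonnegative integer entries and determinant $1$. Fixed points are taken for the Möbius action on $\partial\mathcal{H}=\mathbb{P}^1\mathbb{R}$; $\alpha^\pm$ ($\beta^\pm$) are the attracting/repelling fixed points of $A$ ($B$), equal to the unique fixed point if parabolic. With $\partial\mathcal{H}$ cyclically ordered and $[\alpha,\beta]$ the closed counterclockwise interval from $\alpha$ to $\beta$, let $I^+=\{\alpha^+\}$ if $\alpha^+=\beta^+$, and otherwise the one of $[\alpha^+,\beta^+],[\beta^+,\alpha^+]$ mapped into itself by both $A$ and $B$ (if it exists); define $I^-$ likewise with $A^{-1},B^{-1},\alpha^-,\beta^-$. The pair is coherently oriented if both exist, and well oriented if $A,B$ is coherently oriented but $A,B^{-1}$ is not. Words: $F_2^+$ is the free semigroup of nonempty words over $\{a,b\}$, $|w|$ the length, $\phi(a)=A,\phi(b)=B$, $[w]=\mathrm{tr}(\phi(w))$. Define $w\preceq u$ iff $[w^{|u|}]\le[u^{|w|}]$; $w$ is maximal if $u\preceq w$ for all $u$. A Lyndon word is one strictly smaller lexicographically ($a<b$) than each of its proper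 rotations. A complete set of optimal words is a set of pairwise distinct maximal Lyndon words such that every maximal word is a power of a rotation of one of them; it is unique if it exists, and its elements are the optimal words. *)

theory Defs
  imports "HOL-Analysis.Analysis"
begin

type_synonym imat = "int^2^2"

definition SL2_nonneg :: "imat \<Rightarrow> bool" where
  "SL2_nonneg A \<longleftrightarrow> (\<forall>i j. A$i$j \<ge> 0) \<and> det A = 1"

definition sl2inv :: "imat \<Rightarrow> imat" where
  "sl2inv A = vector [vector [A$2$2, - A$1$2], vector [- A$2$1, A$1$1]]"

section \<open>The boundary of the upper half plane, P^1(R) = R \<union> {\<infinity>}\<close>

datatype bpt = Fin real | Infty

definition mob :: "imat \<Rightarrow> bpt \<Rightarrow> bpt" where
  "mob A p = (let a = real_of_int (A$1$1); b = real_of_int (A$1$2);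
                  c = real_of_int (A$2$1); d = real_of_int (A$2$2) in
     (case p of
        Fin x \<Rightarrow> (if c * x + d = 0 then Infty else Fin ((a * x + b) / (c * x + d)))
      | Infty \<Rightarrow> (if c = 0 then Infty else Fin (a / c))))"

text \<open>p is a fixed point whose homogeneous representative (x,1) resp. (1,0)
  is an eigenvector of A with eigenvalue l.\<close>
definition eigpt :: "imat \<Rightarrow> bpt \<Rightarrow> real \<Rightarrow> bool" where
  "eigpt A p l = (let a = real_of_int (A$1$1); b = real_of_int (A$1$2);
                  c = real_of_int (A$2$1); d = real_of_int (A$2$2) in
     (case p of
        Fin x \<Rightarrow> a * x + b = l * x \<and> c * x + d = l
      | Infty \<Rightarrow> a = l \<and> c = 0))"

text \<open>Attracting fixed point (eigenvalue of modulus > 1, or the unique fixed point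
  if parabolic) and repelling fixed point (eigenvalue of modulus < 1, or the unique
  fixed point if parabolic).\<close>
definition attr_fp :: "imat \<Rightarrow> bpt" where
  "attr_fp A = (THE p. \<exists>l. \<bar>l\<bar> \<ge> 1 \<and> eigpt A p l)"

definition rep_fp :: "imat \<Rightarrow> bpt" where
  "rep_fp A = (THE p. \<exists>l. \<bar>l\<bar> \<le> 1 \<and> eigpt A p l)"

text \<open>Cyclic (counterclockwise) order on the boundary: increasing along R, through \<infinity>.\<close>
fun ble :: "bpt \<Rightarrow> bpt \<Rightarrow> bool" where
  "ble (Fin x) (Fin y) = (x \<le> y)"
| "ble (Fin x) Infty = True"
| "ble Infty (Fin y) = False"
| "ble Infty Infty = True"

definition ccw_int :: "bpt \<Rightarrow> bpt \<Rightarrow> bpt set" where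
  "ccw_int p q = {x. if ble p q then ble p x \<and> ble x q else ble p x \<or> ble x q}"

definition invariant_int :: "imat \<Rightarrow> imat \<Rightarrow> bpt set \<Rightarrow> bool" where
  "invariant_int A B J \<longleftrightarrow> mob A ` J \<subseteq> J \<and> mob B ` J \<subseteq> J"

definition coherently_oriented :: "imat \<Rightarrow> imat \<Rightarrow> bool" where
  "coherently_oriented A B \<longleftrightarrow>
     (attr_fp A = attr_fp B
       \<or> invariant_int A B (ccw_int (attr_fp A) (attr_fp B))
       \<or> invariant_int A B (ccw_int (attr_fp B) (attr_fp A)))
   \<and> (rep_fp A = rep_fp B
       \<or> invariant_int (sl2inv A) (sl2inv B) (ccw_int (rep_fp A) (rep_fp B))
       \<or> invariant_int (sl2inv A) (sl2inv B) (ccw_int (rep_fp B) (rep_fp A)))"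

definition well_oriented :: "imat \<Rightarrow> imat \<Rightarrow> bool" where
  "well_oriented A B \<longleftrightarrow> coherently_oriented A B \<and> \<not> coherently_oriented A (sl2inv B)"

datatype gen = GA | GB

fun gmat :: "imat \<Rightarrow> imat \<Rightarrow> gen \<Rightarrow> imat" where
  "gmat A B GA = A"
| "gmat A B GB = B"

definition phi :: "imat \<Rightarrow> imat \<Rightarrow> gen list \<Rightarrow> imat" where
  "phi A B w = foldr (\<lambda>x M. gmat A B x ** M) w (mat 1)"

definition wtr :: "imat \<Rightarrow> imat \<Rightarrow> gen list \<Rightarrow> int" where
  "wtr A B w = trace (phi A B w)"

definition wpow :: "gen list \<Rightarrow> nat \<Rightarrow> gen list" where
  "wpow w n = concat (replicate n w)"

definition wle :: "imat \<Rightarrow> imat \<Rightarrow> gen list \<Rightarrow> gen list \<Rightarrow> bool" where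
  "wle A B w u \<longleftrightarrow> wtr A B (wpow w (length u)) \<le> wtr A B (wpow u (length w))"

definition maximal_word :: "imat \<Rightarrow> imat \<Rightarrow> gen list \<Rightarrow> bool" where
  "maximal_word A B w \<longleftrightarrow> w \<noteq> [] \<and> (\<forall>u. u \<noteq> [] \<longrightarrow> wle A B u w)"

text \<open>Strict lexicographic order (a < b) on words of equal length.\<close>
definition lex_less :: "gen list \<Rightarrow> gen list \<Rightarrow> bool" where
  "lex_less u v \<longleftrightarrow> (\<exists>p s t. u = p @ [GA] @ s \<and> v = p @ [GB] @ t)"

definition lyndon :: "gen list \<Rightarrow> bool" where
  "lyndon w \<longleftrightarrow> w \<noteq> [] \<and> (\<forall>k. 0 < k \<and> k < length w \<longrightarrow> lex_less w (rotate k w))"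

definition complete_optimal :: "imat \<Rightarrow> imat \<Rightarrow> gen list set \<Rightarrow> bool" where
  "complete_optimal A B S \<longleftrightarrow>
     (\<forall>w\<in>S. maximal_word A B w \<and> lyndon w)
   \<and> (\<forall>w. maximal_word A B w \<longrightarrow> (\<exists>v\<in>S. \<exists>k n. n \<ge> 1 \<and> w = wpow (rotate k v) n))"

end

theory Submission
  imports Defs "HOL-Library.Sublist"
begin

text \<open>
  Let \<open>x, y, z\<close> be the traces of \<open>A, B, AB\<close>; the hypotheses force \<open>z \<ge> xy\<close>.

  Write the matrix \<open>W\<close> of a word in the basis \<open>1, A, B, AB\<close>. The reversed word has the same coordinates
  in \<open>1, A, B, BA\<close>, so the two matrices differ by a multiple of \<open>K = AB - BA\<close>, with factor
  \<open>tr(WK) / tr(ABK)\<close>. Since \<open>BKA = (z - xy)BA + A\<^sup>2 + B\<^sup>2\<close>, the traces \<open>tr(a s b K)\<close> are positive and the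
  traces \<open>tr(b s a K)\<close> negative. Hence reversing the factor \<open>a s b\<close> of a cyclic word \<open>a s b b t a\<close>
  increases the trace, and a word of maximal trace for its length cannot contain both \<open>aa\<close> and \<open>bb\<close>
  cyclically: up to rotation it is a word in \<open>a, ab\<close> or in \<open>b, ab\<close>.

  For words in \<open>b\<close> and \<open>ab\<close>, diagonalise \<open>AB = diag(r, 1/r)\<close>. The cone between the attracting directions
  of \<open>AB\<close> and \<open>B\<close> is invariant, and on it the first coordinate is multiplied by \<open>r\<close> under \<open>AB\<close> and by at
  most \<open>p = (yr - x)/(r - 1/r)\<close> under \<open>B\<close>. Hence \<open>p < \<surd>r\<close> makes \<open>ab\<close> the only optimal word.
  Integrality shows that this fails only if \<open>z = y\<^sup>2 - 1\<close> and \<open>2x \<le> y\<close>. In that case the same argument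
  for the pair \<open>AB, B\<close>, with letters of length 2 and 1, shows that \<open>ab\<^sup>2\<close> wins.
\<close>

section \<open>Two by two matrices\<close>

lemma matrix_eq_iff_2:
  fixes M N :: "'a^2^2"
  shows "M = N \<longleftrightarrow> M$1$1 = N$1$1 \<and> M$1$2 = N$1$2 \<and> M$2$1 = N$2$1 \<and> M$2$2 = N$2$2"
  by (auto simp: vec_eq_iff forall_2)

lemma matrix_mult_nth_2:
  fixes M N :: "'a::semiring_1^2^2"
  shows "(M ** N)$i$j = M$i$1 * N$1$j + M$i$2 * N$2$j"
  by (simp add: matrix_matrix_mult_def sum_2)

lemma trace_2:
  fixes M :: "'a::semiring_1^2^2"
  shows "trace M = M$1$1 + M$2$2"
  by (simp add: trace_def sum_2)

lemma trace_transpose: "trace (transpose M) = trace M"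
  by (simp add: trace_def transpose_def)

lemma trace_scaleR: "trace (c *\<^sub>R M) = c * trace M" for M :: "real^'n^'n"
  by (simp add: trace_def sum_distrib_left)

lemma trace_square:
  fixes M :: "'a::idom^2^2"
  assumes "det M = 1"
  shows "trace (M ** M) = (trace M)\<^sup>2 - 2"
  using assms by (simp add: trace_2 matrix_mult_nth_2 det_2) algebra

lemma trace_mult_square:
  fixes X Y :: "'a::idom^2^2"
  assumes "det Y = 1"
  shows "trace (X ** Y ** Y) = trace Y * trace (X ** Y) - trace X"
  using assms by (simp add: trace_2 matrix_mult_nth_2 det_2) algebra

lemma trace_square_mult:
  fixes X Y :: "'a::idom^2^2"
  assumes "det X = 1"
  shows "trace (X ** X ** Y) = trace X * trace (X ** Y) - trace Y"
  using assms by (simp add: trace_2 matrix_mult_nth_2 det_2) algebra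

lemma trace_cube:
  fixes M :: "'a::idom^2^2"
  assumes "det M = 1"
  shows "trace (M ** M ** M) = trace M ^ 3 - 3 * trace M"
  using assms by (simp add: trace_mult_square trace_square algebra_simps power2_eq_square power3_eq_cube)

definition commutator :: "'a::ring_1^'n^'n \<Rightarrow> 'a^'n^'n \<Rightarrow> 'a^'n^'n" where
  "commutator X Y = X ** Y - Y ** X"

definition fricke :: "'a::comm_ring_1 \<Rightarrow> 'a \<Rightarrow> 'a \<Rightarrow> 'a" where
  "fricke x y z = z\<^sup>2 - x * y * z + x\<^sup>2 + y\<^sup>2 - 4"

lemma neg_det_commutator:
  fixes X Y :: "'a::idom^2^2"
  assumes "det X = 1" "det Y = 1"
  shows "- det (commutator X Y) = fricke (trace X) (trace Y) (trace (X ** Y))"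
  using assms by (simp add: commutator_def fricke_def trace_2 matrix_mult_nth_2 det_2) algebra

lemma trace_mult_commutator:
  fixes X Y :: "'a::comm_ring_1^2^2"
  shows "trace (X ** Y ** commutator X Y) = - det (commutator X Y)"
  by (simp add: commutator_def trace_2 matrix_mult_nth_2 det_2 algebra_simps)

lemma mult_commutator_mult:
  fixes X Y :: "real^2^2"
  assumes "det X = 1" "det Y = 1"
  shows "Y ** commutator X Y ** X
    = (trace (X ** Y) - trace X * trace Y) *\<^sub>R (Y ** X) + X ** X + Y ** Y"
  using assms
  by (simp add: matrix_eq_iff_2 commutator_def trace_2 matrix_mult_nth_2 det_2) algebra

lemma mult_commutator_same:
  fixes X Y :: "'a::idom^2^2"
  assumes "det Y = 1"
  shows "Y ** commutator X Y ** Y = commutator X Y"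
  using assms
  by (simp add: matrix_eq_iff_2 commutator_def matrix_mult_nth_2 det_2) algebra

lemma commutator_mult_left:
  fixes X Y :: "'a::ring_1^2^2"
  shows "commutator (X ** Y) Y = commutator X Y ** Y"
  by (simp add: matrix_eq_iff_2 commutator_def matrix_mult_nth_2 algebra_simps)

section \<open>Words in two matrices\<close>

fun word_mat :: "'a::semiring_1^'n^'n \<Rightarrow> 'a^'n^'n \<Rightarrow> gen list \<Rightarrow> 'a^'n^'n" where
  "word_mat X Y [] = mat 1"
| "word_mat X Y (GA # w) = X ** word_mat X Y w"
| "word_mat X Y (GB # w) = Y ** word_mat X Y w"

lemma word_mat_append: "word_mat X Y (u @ v) = word_mat X Y u ** word_mat X Y v"
  by (induction X Y u rule: word_mat.induct) (simp_all add: matrix_mul_assoc)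

lemma det_word_mat: "det X = 1 \<Longrightarrow> det Y = 1 \<Longrightarrow> det (word_mat X Y w) = 1"
  by (induction X Y w rule: word_mat.induct) (simp_all add: det_mul)

lemma transpose_word_mat:
  fixes X Y :: "'a::comm_semiring_1^'n^'n"
  shows "transpose (word_mat X Y w) = word_mat (transpose X) (transpose Y) (rev w)"
  by (induction X Y w rule: word_mat.induct) (simp_all add: word_mat_append matrix_transpose_mul)

definition basis_comb :: "real^2^2 \<Rightarrow> real^2^2 \<Rightarrow> real \<Rightarrow> real \<Rightarrow> real \<Rightarrow> real \<Rightarrow> real^2^2" where
  "basis_comb X Y a b c d = a *\<^sub>R mat 1 + b *\<^sub>R X + c *\<^sub>R Y + d *\<^sub>R (X ** Y)"

lemmas basis_comb_entries = basis_comb_def matrix_mult_nth_2 mat_def trace_2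

lemma basis_comb_mult_left:
  assumes "det X = 1"
  shows "X ** basis_comb X Y a b c d
    = basis_comb X Y (- b) (a + b * trace X) (- d) (c + d * trace X)"
  using assms by (simp add: matrix_eq_iff_2 basis_comb_entries det_2) algebra

lemma basis_comb_mult_right:
  assumes "det X = 1" "det Y = 1"
  defines "x \<equiv> trace X" and "y \<equiv> trace Y" and "z \<equiv> trace (X ** Y)"
  shows "Y ** basis_comb X Y a b c d
    = basis_comb X Y (b * (z - x * y) - c - d * x) (b * y + d) (a + b * x + c * y + d * z) (- b)"
  using assms(1,2) unfolding x_def y_def z_def
  by (simp add: matrix_eq_iff_2 basis_comb_entries det_2) algebra

lemma trace_basis_comb:
  "trace (basis_comb X Y a b c d) = 2 * a + b * trace X + c * trace Y + d * trace (X ** Y)"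
  by (simp add: basis_comb_entries algebra_simps)

text \<open>The coordinates depend on \<open>X\<close> and \<open>Y\<close> through the three traces alone, hence the order of the
  quantifiers.\<close>

lemma word_mat_coordinates:
  "\<exists>a b c d. \<forall>X Y. det X = 1 \<longrightarrow> det Y = 1 \<longrightarrow> trace X = x \<longrightarrow> trace Y = y \<longrightarrow> trace (X ** Y) = z
    \<longrightarrow> word_mat X Y w = basis_comb X Y a b c d"
proof (induction w)
  case Nil
  have "word_mat X Y [] = basis_comb X Y 1 0 0 0" for X Y
    by (simp add: basis_comb_def)
  then show ?case by blast
next
  case (Cons g w)
  then obtain a b c d where coords: "word_mat X Y w = basis_comb X Y a b c d"
    if "det X = 1" "det Y = 1" "trace X = x" "trace Y = y" "trace (X ** Y) = z" for X Y
    by blast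
  show ?case
  proof (cases g)
    case GA
    then have "word_mat X Y (g # w) = basis_comb X Y (- b) (a + b * x) (- d) (c + d * x)"
      if "det X = 1" "det Y = 1" "trace X = x" "trace Y = y" "trace (X ** Y) = z" for X Y
      using that by (simp add: coords basis_comb_mult_left)
    then show ?thesis by blast
  next
    case GB
    then have "word_mat X Y (g # w)
        = basis_comb X Y (b * (z - x * y) - c - d * x) (b * y + d) (a + b * x + c * y + d * z) (- b)"
      if "det X = 1" "det Y = 1" "trace X = x" "trace Y = y" "trace (X ** Y) = z" for X Y
      using that by (simp add: coords basis_comb_mult_right)
    then show ?thesis by blast
  qed
qed

lemma trace_word_mat_cong:
  fixes X Y X' Y' :: "real^2^2"
  assumes "det X = 1" "det Y = 1" "det X' = 1" "det Y' = 1"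
    and "trace X = trace X'" "trace Y = trace Y'" "trace (X ** Y) = trace (X' ** Y')"
  shows "trace (word_mat X Y w) = trace (word_mat X' Y' w)"
proof -
  obtain a b c d where "word_mat X Y w = basis_comb X Y a b c d"
    and "word_mat X' Y' w = basis_comb X' Y' a b c d"
    using word_mat_coordinates[of "trace X'" "trace Y'" "trace (X' ** Y')" w] assms by blast
  with assms show ?thesis by (simp add: trace_basis_comb)
qed

text \<open>Transposition reverses words and preserves the three traces, so the reversal of \<open>w\<close> has the
  coordinates of \<open>w\<close>, taken in \<open>1, X, Y, YX\<close>.\<close>

lemma word_mat_rev_difference:
  fixes X Y :: "real^2^2"
  assumes "det X = 1" "det Y = 1"
  defines "K \<equiv> commutator X Y"
  obtains d where "word_mat X Y w - word_mat X Y (rev w) = d *\<^sub>R K"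
    and "trace (word_mat X Y w ** K) = - d * det K" and "trace (word_mat X Y (rev w) ** K) = d * det K"
proof -
  let ?X = "transpose X" and ?Y = "transpose Y"
  have "trace (?X ** ?Y) = trace (X ** Y)"
    by (metis matrix_transpose_mul trace_transpose trace_mul_sym)
  then obtain a b c d where coords: "word_mat X Y w = basis_comb X Y a b c d"
    and coords': "word_mat ?X ?Y w = basis_comb ?X ?Y a b c d"
    using word_mat_coordinates[of "trace X" "trace Y" "trace (X ** Y)" w] assms
    by (metis det_transpose trace_transpose)
  have "word_mat X Y (rev w) = transpose (basis_comb ?X ?Y a b c d)"
    by (simp add: transpose_word_mat flip: coords')
  also have "\<dots> = a *\<^sub>R mat 1 + b *\<^sub>R X + c *\<^sub>R Y + d *\<^sub>R (Y ** X)"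
    by (simp add: matrix_eq_iff_2 basis_comb_entries transpose_def algebra_simps)
  finally have rev: "word_mat X Y (rev w) = a *\<^sub>R mat 1 + b *\<^sub>R X + c *\<^sub>R Y + d *\<^sub>R (Y ** X)" .
  show thesis
  proof
    show "word_mat X Y w - word_mat X Y (rev w) = d *\<^sub>R K"
      by (simp add: coords rev basis_comb_def K_def commutator_def algebra_simps)
    show "trace (word_mat X Y w ** K) = - d * det K" "trace (word_mat X Y (rev w) ** K) = d * det K"
      by (simp_all add: coords rev basis_comb_entries K_def commutator_def det_2 algebra_simps)
  qed
qed

section \<open>Substitutions, weights and rotations\<close>

fun substitute :: "gen list \<Rightarrow> gen list \<Rightarrow> gen list \<Rightarrow> gen list" where
  "substitute u v [] = []"
| "substitute u v (GA # w) = u @ substitute u v w"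
| "substitute u v (GB # w) = v @ substitute u v w"

lemma substitute_append: "substitute u v (w @ w') = substitute u v w @ substitute u v w'"
  by (induction u v w rule: substitute.induct) simp_all

lemma word_mat_substitute:
  "word_mat X Y (substitute u v w) = word_mat (word_mat X Y u) (word_mat X Y v) w"
  by (induction u v w rule: substitute.induct) (simp_all add: word_mat_append)

lemma substitute_AB_B_conjugate:
  "GB # substitute [GA, GB] [GB] w = substitute [GB, GA] [GB] w @ [GB]"
  by (induction "[GA, GB]" "[GB]" w rule: substitute.induct) simp_all

definition weight :: "nat \<Rightarrow> nat \<Rightarrow> gen list \<Rightarrow> nat" where
  "weight a b w = a * count_list w GA + b * count_list w GB"

lemma weight_simps [simp]:
  "weight a b [] = 0"
  "weight a b (GA # w) = a + weight a b w"
  "weight a b (GB # w) = b + weight a b w"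
  "weight a b (u @ v) = weight a b u + weight a b v"
  "weight a b (rev w) = weight a b w"
  by (simp_all add: weight_def algebra_simps)

lemma weight_1_1: "weight 1 1 w = length w" "weight (Suc 0) (Suc 0) w = length w"
  by (induction "[] :: gen list" "[] :: gen list" w rule: substitute.induct) simp_all

lemma weight_substitute: "weight a b (substitute u v w) = weight (weight a b u) (weight a b v) w"
  by (induction u v w rule: substitute.induct) simp_all

lemma wpow_0 [simp]: "wpow w 0 = []" and wpow_Suc [simp]: "wpow w (Suc n) = w @ wpow w n"
  by (simp_all add: wpow_def)

lemma weight_wpow: "weight a b (wpow w n) = n * weight a b w"
  by (induction n) simp_all

lemma length_wpow: "length (wpow w n) = n * length w"
  by (induction n) simp_all

lemma substitute_wpow: "substitute u v (wpow w n) = wpow (substitute u v w) n"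
  by (induction n) (simp_all add: substitute_append)

lemma substitute_eq_wpow_left: "count_list w GB = 0 \<Longrightarrow> substitute u v w = wpow u (count_list w GA)"
  by (induction u v w rule: substitute.induct) simp_all

lemma substitute_eq_wpow_right: "count_list w GA = 0 \<Longrightarrow> substitute u v w = wpow v (count_list w GB)"
  by (induction u v w rule: substitute.induct) simp_all

lemma substitute_A_AB_surj:
  assumes "w = [] \<or> hd w = GA" "\<not> sublist [GB, GB] w"
  obtains u where "w = substitute [GA] [GA, GB] u"
proof -
  have "\<exists>u. w = substitute [GA] [GA, GB] u"
    using assms
  proof (induction w rule: rev_induct)
    case Nil
    show ?case by (rule exI[of _ "[]"]) simp
  next
    case (snoc g w)
    have "w = [] \<or> hd w = GA" "\<not> sublist [GB, GB] w"
      using snoc.prems by (auto simp: hd_append sublist_append split: if_splits)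
    with snoc.IH obtain u where u: "w = substitute [GA] [GA, GB] u" by blast
    show ?case
    proof (cases g)
      case GA
      with u have "w @ [g] = substitute [GA] [GA, GB] (u @ [GA])"
        by (simp add: substitute_append)
      then show ?thesis by blast
    next
      case GB
      with snoc.prems u have "u \<noteq> []" by auto
      then obtain u' h where h: "u = u' @ [h]" by (metis rev_exhaust)
      have "h = GA"
      proof (rule ccontr)
        assume "h \<noteq> GA"
        with h u GB have "w @ [g] = (substitute [GA] [GA, GB] u' @ [GA]) @ [GB, GB] @ []"
          by (cases h) (simp_all add: substitute_append)
        with snoc.prems(2) show False unfolding sublist_def by blast
      qed
      with h u GB have "w @ [g] = substitute [GA] [GA, GB] (u' @ [GB])"
        by (simp add: substitute_append)
      then show ?thesis by blast
    qed
  qed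
  with that show thesis by blast
qed

lemma substitute_AB_B_surj:
  assumes "w = [] \<or> last w = GB" "\<not> sublist [GA, GA] w"
  obtains u where "w = substitute [GA, GB] [GB] u"
proof -
  have "\<exists>u. w = substitute [GA, GB] [GB] u"
    using assms
  proof (induction w)
    case Nil
    show ?case by (rule exI[of _ "[]"]) simp
  next
    case (Cons g w)
    have "w = [] \<or> last w = GB" "\<not> sublist [GA, GA] w"
      using Cons.prems by (auto simp: sublist_Cons_right split: if_splits)
    with Cons.IH obtain u where u: "w = substitute [GA, GB] [GB] u" by blast
    show ?case
    proof (cases g)
      case GA
      with Cons.prems u have "u \<noteq> []" by auto
      then obtain h u' where h: "u = h # u'" by (metis list.exhaust)
      have "h = GB"
        using Cons.prems(2) h u GA by (cases h) (auto simp: sublist_Cons_right)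
      with h u GA have "g # w = substitute [GA, GB] [GB] (GA # u')" by simp
      then show ?thesis by blast
    next
      case GB
      with u have "g # w = substitute [GA, GB] [GB] (GB # u)" by simp
      then show ?thesis by blast
    qed
  qed
  with that show thesis by blast
qed

definition rotation_of :: "'a list \<Rightarrow> 'a list \<Rightarrow> bool" where
  "rotation_of u w \<longleftrightarrow> (\<exists>k. u = rotate k w)"

lemma rotation_of_iff: "rotation_of u w \<longleftrightarrow> (\<exists>p q. w = p @ q \<and> u = q @ p)"
proof
  assume "rotation_of u w"
  then show "\<exists>p q. w = p @ q \<and> u = q @ p"
    unfolding rotation_of_def by (metis append_take_drop_id rotate_drop_take)
next
  assume "\<exists>p q. w = p @ q \<and> u = q @ p"
  then show "rotation_of u w"
    unfolding rotation_of_def by (metis rotate_append)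
qed

lemma rotation_of_refl: "rotation_of w w"
  unfolding rotation_of_def by (rule exI[of _ 0]) simp

lemma rotation_of_sym: "rotation_of u w \<Longrightarrow> rotation_of w u"
  unfolding rotation_of_iff by blast

lemma rotation_of_trans: "rotation_of u v \<Longrightarrow> rotation_of v w \<Longrightarrow> rotation_of u w"
  unfolding rotation_of_def by (metis rotate_rotate)

lemma rotation_of_weight: "rotation_of u w \<Longrightarrow> weight a b u = weight a b w"
  unfolding rotation_of_iff by auto

lemma rotation_of_substitute: "rotation_of u w \<Longrightarrow> rotation_of (substitute s t u) (substitute s t w)"
  unfolding rotation_of_iff by (metis substitute_append)

lemma trace_word_mat_rotation:
  fixes X Y :: "'a::comm_semiring_1^'n^'n"
  shows "rotation_of u w \<Longrightarrow> trace (word_mat X Y u) = trace (word_mat X Y w)"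
  unfolding rotation_of_iff by (metis word_mat_append trace_mul_sym)

lemma rotation_of_substitute_AB_B:
  assumes no_AA: "\<And>v. \<not> rotation_of (GA # v @ [GA]) w" and "w \<noteq> [GA]"
  obtains u where "rotation_of (substitute [GA, GB] [GB] u) w"
proof -
  obtain v where v: "rotation_of v w" "v = [] \<or> last v = GB"
  proof (cases "w = [] \<or> last w = GB")
    case True
    with that rotation_of_refl show thesis by blast
  next
    case False
    then obtain w' where w': "w = w' @ [GA]"
      by (metis append_butlast_last_id gen.exhaust)
    with \<open>w \<noteq> [GA]\<close> obtain g w'' where "w' = g # w''" by (metis append_Nil list.exhaust)
    with w' no_AA[of w''] rotation_of_refl have "w = [GB] @ (w'' @ [GA])"
      by (cases g) auto
    then have "rotation_of ((w'' @ [GA]) @ [GB]) w"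
      unfolding rotation_of_iff by blast
    with that show thesis by simp
  qed
  have "\<not> sublist [GA, GA] v"
  proof
    assume "sublist [GA, GA] v"
    then obtain p q where "v = (p @ [GA]) @ (GA # q)"
      unfolding sublist_def by auto
    then have "rotation_of (GA # (q @ p) @ [GA]) v"
      unfolding rotation_of_iff by (metis append_Cons append_assoc)
    with v(1) no_AA show False
      using rotation_of_trans by blast
  qed
  with v that show thesis by (metis substitute_AB_B_surj)
qed

lemma rotation_cases:
  obtains (A_AB) u where "rotation_of (substitute [GA] [GA, GB] u) w"
  | (AB_B) u where "rotation_of (substitute [GA, GB] [GB] u) w"
  | (AA_BB) s t where "rotation_of (GA # s @ [GB, GB] @ t @ [GA]) w"
proof (cases "w = [GA] \<or> (\<exists>v. rotation_of (GA # v @ [GA]) w)")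
  case False
  with AB_B show thesis by (metis rotation_of_substitute_AB_B)
next
  case True
  then obtain v where v: "rotation_of v w" "v \<noteq> []" "hd v = GA" "last v = GA"
    using rotation_of_refl by fastforce
  show thesis
  proof (cases "sublist [GB, GB] v")
    case True
    then obtain p q where pq: "v = p @ [GB, GB] @ q" unfolding sublist_def by blast
    from v pq obtain s where "p = GA # s" by (cases p) auto
    moreover from v pq obtain t where "q = t @ [GA]" by (cases q rule: rev_cases) auto
    ultimately show thesis using AA_BB v(1) pq by simp
  next
    case False
    with v A_AB show thesis by (metis substitute_A_AB_surj)
  qed
qed

section \<open>Dominant eigenvalues and leading entries\<close>

definition dominant_root :: "real \<Rightarrow> real" where
  "dominant_root s = (s + sqrt (s\<^sup>2 - 4)) / 2"

lemma dominant_root_ge_1: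
  assumes "2 \<le> s"
  shows "1 \<le> dominant_root s"
proof -
  have "4 \<le> s\<^sup>2" using power_mono[of 2 s 2] assms by simp
  with assms have "2 + 0 \<le> s + sqrt (s\<^sup>2 - 4)" by (intro add_mono) simp_all
  then show ?thesis by (simp add: dominant_root_def)
qed

lemma dominant_root_add_inverse:
  assumes "2 \<le> s"
  shows "dominant_root s + 1 / dominant_root s = s"
proof -
  have "0 \<le> s\<^sup>2 - 4" using power_mono[of 2 s 2] assms by simp
  then have "(sqrt (s\<^sup>2 - 4))\<^sup>2 = s\<^sup>2 - 4" by simp
  then have "dominant_root s * dominant_root s + 1 = s * dominant_root s"
    by (simp add: dominant_root_def field_simps power2_eq_square)
  then show ?thesis
    using dominant_root_ge_1[OF assms] by (simp add: add_divide_eq_iff)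
qed

lemma dominant_root_gt_1:
  assumes "2 < s"
  shows "1 < dominant_root s"
  using dominant_root_ge_1[of s] dominant_root_add_inverse[of s] assms
  by (cases "dominant_root s = 1") auto

lemma add_inverse_strict_mono:
  fixes m n :: real
  assumes "1 \<le> m" "m < n"
  shows "m + 1 / m < n + 1 / n"
proof -
  have "1 * 1 < n * m" using assms by (intro mult_less_le_imp_less) auto
  then have "0 < (n - m) * (n * m - 1)"
    using assms by (intro mult_pos_pos) auto
  then show ?thesis using assms by (simp add: field_simps)
qed

text \<open>Let \<open>x, y, z\<close> be the traces of \<open>X, Y, XY\<close>. In an eigenbasis in which \<open>XY = diag(r, 1/r)\<close>, the entry
  \<open>p\<close> of \<open>X\<close> at \<open>(1, 1)\<close> satisfies \<open>p r + (x - p) / r = tr(XXY) = x (r + 1/r) - y\<close>.\<close>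

definition leading_entry :: "real \<Rightarrow> real \<Rightarrow> real \<Rightarrow> real" where
  "leading_entry x y z
    = (x * dominant_root z - y) / (dominant_root z - 1 / dominant_root z)"

lemma dominant_root_minus_inverse:
  assumes "2 < z"
  shows "0 < dominant_root z - 1 / dominant_root z"
    and "(dominant_root z - 1 / dominant_root z)\<^sup>2 = z\<^sup>2 - 4"
proof -
  have root: "1 < dominant_root z" "dominant_root z + 1 / dominant_root z = z"
    using assms by (simp_all add: dominant_root_gt_1 dominant_root_add_inverse)
  then show "0 < dominant_root z - 1 / dominant_root z"
    by (simp add: field_simps less_1_mult)
  have "(dominant_root z - 1 / dominant_root z)\<^sup>2 = (dominant_root z + 1 / dominant_root z)\<^sup>2 - 4"
    using root(1) by (simp add: field_simps power2_eq_square)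
  then show "(dominant_root z - 1 / dominant_root z)\<^sup>2 = z\<^sup>2 - 4" by (simp add: root(2))
qed

lemma leading_entry_less_iff:
  assumes "2 < z"
  shows "leading_entry x y z < c
    \<longleftrightarrow> x * dominant_root z - y < c * (dominant_root z - 1 / dominant_root z)"
  using dominant_root_minus_inverse(1)[OF assms]
  by (simp add: leading_entry_def pos_divide_less_eq)

lemma leading_entry_quadratic:
  fixes x y z :: real
  assumes "2 < z"
  defines "r \<equiv> dominant_root z" and "p \<equiv> leading_entry x y z"
  shows "(1 - p * (x - p)) * (r - 1 / r)\<^sup>2 = fricke x y z"
proof -
  define D where "D = r - 1 / r"
  have r: "1 < r" "r + 1 / r = z"
    using assms(1) by (simp_all add: r_def dominant_root_gt_1 dominant_root_add_inverse)
  have D: "0 < D" "D\<^sup>2 = z\<^sup>2 - 4"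
    using dominant_root_minus_inverse[OF assms(1)] by (simp_all add: D_def r_def)
  have p_mult_D: "p * D = x * r - y"
    using D(1) by (simp add: p_def leading_entry_def D_def r_def)
  have "(1 - p * (x - p)) * D\<^sup>2 = D\<^sup>2 - p * D * (x * D - p * D)"
    by (simp add: algebra_simps power2_eq_square)
  also have "\<dots> = D\<^sup>2 - (x * r - y) * (y - x / r)"
    unfolding p_mult_D by (simp add: D_def algebra_simps)
  also have "\<dots> = fricke x y z"
    unfolding D(2) fricke_def using r(1) by (simp add: field_simps power2_eq_square flip: r(2))
  finally show ?thesis by (simp add: D_def)
qed

lemma le_double_leading_entry:
  assumes "2 < z" "2 * y \<le> x * z"
  shows "x \<le> 2 * leading_entry x y z"
proof -
  define r where "r = dominant_root z"
  have r: "r + 1 / r = z" using assms(1) by (simp add: r_def dominant_root_add_inverse)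
  have D: "0 < r - 1 / r" using dominant_root_minus_inverse(1)[OF assms(1)] by (simp add: r_def)
  have "x * (r - 1 / r) \<le> 2 * (x * r - y)"
    using assms(2) by (simp add: algebra_simps flip: r)
  then have "x \<le> 2 * (x * r - y) / (r - 1 / r)" using D by (simp add: pos_le_divide_eq)
  then show ?thesis by (simp add: leading_entry_def r_def)
qed

lemma dominant_root_le_leading_entry:
  assumes "2 \<le> x" "2 < z" "2 * y \<le> x * z" "0 \<le> fricke x y z"
  shows "dominant_root x \<le> leading_entry x y z"
proof -
  let ?p = "leading_entry x y z"
  define l where "l = dominant_root x"
  have l: "1 \<le> l" "l + 1 / l = x"
    using assms(1) by (simp_all add: l_def dominant_root_ge_1 dominant_root_add_inverse)
  have "0 \<le> 1 - ?p * (x - ?p)"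
    using leading_entry_quadratic[OF assms(2), of x y] dominant_root_minus_inverse(1)[OF assms(2)]
      assms(4) by (metis less_irrefl linorder_not_le mult_neg_pos zero_less_power order_less_le_trans)
  also have "1 - ?p * (x - ?p) = (?p - l) * (?p - 1 / l)"
    using l(1) by (simp add: field_simps flip: l(2))
  finally have "0 \<le> (?p - l) * (?p - 1 / l)" .
  moreover have "0 < ?p - 1 / l" if "?p < l"
    using that le_double_leading_entry[OF assms(2,3)] l(2) by linarith
  ultimately have "l \<le> ?p" by (smt (verit) mult_neg_pos)
  then show ?thesis by (simp add: l_def)
qed

section \<open>Growth in an invariant cone\<close>

text \<open>The cone is spanned by \<open>(1, 0)\<close> and \<open>(1, 1)\<close>, the attracting directions of \<open>diag_mat r\<close> and
  \<open>eigen_mat p l k\<close> below. The sign of \<open>M$1$2\<close> lets \<open>M$1$1\<close> control the trace.\<close>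

definition in_cone :: "real^2^2 \<Rightarrow> bool" where
  "in_cone M \<longleftrightarrow> det M = 1 \<and> 1 \<le> M$1$1 \<and> M$1$2 \<le> 0 \<and> 0 \<le> M$2$1 \<and> M$2$1 \<le> M$1$1"

definition diag_mat :: "real \<Rightarrow> real^2^2" where
  "diag_mat r = vector [vector [r, 0], vector [0, 1 / r]]"

definition eigen_mat :: "real \<Rightarrow> real \<Rightarrow> real \<Rightarrow> real^2^2" where
  "eigen_mat p l k = vector [vector [p, l - p], vector [p - k, l + k - p]]"

lemma det_diag_mat: "r \<noteq> 0 \<Longrightarrow> det (diag_mat r) = 1"
  and trace_diag_mat: "trace (diag_mat r) = r + 1 / r"
  by (simp_all add: diag_mat_def det_2 trace_2)

lemma det_eigen_mat: "det (eigen_mat p l k) = k * l"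
  and trace_eigen_mat: "trace (eigen_mat p l k) = l + k"
  by (simp_all add: eigen_mat_def det_2 trace_2 algebra_simps)

lemma in_cone_mult_diag_mat:
  assumes "in_cone M" "1 \<le> r"
  shows "in_cone (diag_mat r ** M)"
  unfolding in_cone_def
proof (intro conjI)
  have M: "1 \<le> M$1$1" "M$1$2 \<le> 0" "0 \<le> M$2$1" "M$2$1 \<le> M$1$1"
    using assms(1) by (simp_all add: in_cone_def)
  have entries: "(diag_mat r ** M)$1$1 = r * M$1$1" "(diag_mat r ** M)$1$2 = r * M$1$2"
    "(diag_mat r ** M)$2$1 = M$2$1 / r"
    by (simp_all add: diag_mat_def matrix_mult_nth_2)
  show "det (diag_mat r ** M) = 1"
    using assms by (simp add: in_cone_def det_mul det_diag_mat)
  have grow: "M$1$1 \<le> r * M$1$1"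
    using mult_right_mono[of 1 r "M$1$1"] assms(2) M(1) by simp
  with M(1) show "1 \<le> (diag_mat r ** M)$1$1" unfolding entries by linarith
  show "(diag_mat r ** M)$1$2 \<le> 0" "0 \<le> (diag_mat r ** M)$2$1"
    using M assms(2) by (simp_all add: entries mult_nonneg_nonpos)
  have "M$2$1 / r \<le> M$2$1"
    using mult_left_mono[of 1 r "M$2$1"] assms(2) M(3) by (simp add: field_simps)
  with grow M(4) show "(diag_mat r ** M)$2$1 \<le> (diag_mat r ** M)$1$1"
    unfolding entries by linarith
qed

lemma in_cone_mult_eigen_mat:
  assumes "in_cone M" and p: "l \<le> p" and l: "1 \<le> l" and k: "0 \<le> k" "k \<le> l" "k * l = 1"
  shows "in_cone (eigen_mat p l k ** M)"
  unfolding in_cone_def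
proof (intro conjI)
  let ?a = "M$1$1" and ?b = "M$1$2" and ?c = "M$2$1" and ?d = "M$2$2"
  let ?N = "eigen_mat p l k ** M"
  have M: "?a * ?d - ?b * ?c = 1" "1 \<le> ?a" "?b \<le> 0" "0 \<le> ?c" "?c \<le> ?a"
    using assms(1) by (simp_all add: in_cone_def det_2)
  have entries: "?N$1$1 = l * ?a + (p - l) * (?a - ?c)" "?N$1$2 = p * ?b - (p - l) * ?d"
    "?N$2$1 = (p - k) * (?a - ?c) + l * ?c" "?N$1$1 - ?N$2$1 = k * (?a - ?c)"
    by (simp_all add: eigen_mat_def matrix_mult_nth_2 algebra_simps)
  show "det ?N = 1" using assms by (simp add: in_cone_def det_mul det_eigen_mat)
  have "1 \<le> l * ?a" using mult_mono[of 1 l 1 ?a] l M(2) by simp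
  moreover have "0 \<le> (p - l) * (?a - ?c)" using p M(5) by simp
  ultimately show N11: "1 \<le> ?N$1$1" by (simp add: entries)
  have "?a * ?N$1$2 = ?b * ?N$1$1 - (p - l) * (?a * ?d - ?b * ?c)"
    by (simp add: entries algebra_simps)
  also have "\<dots> \<le> 0"
    unfolding M(1) using M(3) N11 p mult_nonpos_nonneg[of ?b "?N$1$1"] by simp
  finally show "?N$1$2 \<le> 0" using M(2) by (simp add: mult_le_0_iff)
  show "0 \<le> ?N$2$1" unfolding entries using p k l M by simp
  have "0 \<le> k * (?a - ?c)" using k M by simp
  then show "?N$2$1 \<le> ?N$1$1" by (simp flip: entries(4))
qed

lemma trace_le_in_cone:
  assumes "in_cone M"
  shows "trace M \<le> M$1$1 + 1 / M$1$1"
proof -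
  have "M$1$2 * M$2$1 \<le> 0"
    using assms by (simp add: in_cone_def mult_nonpos_nonneg)
  then have "M$1$1 * M$2$2 \<le> 1"
    using assms by (simp add: in_cone_def det_2)
  then have "M$2$2 \<le> 1 / M$1$1"
    using assms by (simp add: in_cone_def field_simps)
  then show ?thesis by (simp add: trace_2)
qed

lemma word_mat_in_cone:
  assumes p: "l \<le> p" and l: "1 \<le> l" and k: "0 \<le> k" "k \<le> l" "k * l = 1" and r: "1 \<le> r"
  defines "W \<equiv> word_mat (eigen_mat p l k) (diag_mat r)"
  shows "in_cone (W w) \<and> W w $ 1 $ 1 \<le> p ^ count_list w GA * r ^ count_list w GB"
proof (induction w)
  case Nil
  show ?case by (simp add: W_def in_cone_def mat_def det_2)
next
  case (Cons g w)
  let ?M = "p ^ count_list w GA * r ^ count_list w GB"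
  have cone: "in_cone (W w)" and entry_le: "W w $ 1 $ 1 \<le> ?M" using Cons.IH by simp_all
  show ?case
  proof (cases g)
    case GA
    then have W: "W (g # w) = eigen_mat p l k ** W w" by (simp add: W_def)
    have "W (g # w) $ 1 $ 1 = p * W w $ 1 $ 1 - (p - l) * W w $ 2 $ 1"
      unfolding W by (simp add: eigen_mat_def matrix_mult_nth_2 algebra_simps)
    also have "\<dots> \<le> p * ?M"
      using cone entry_le p l mult_left_mono[of "W w $ 1 $ 1" ?M p]
      by (smt (verit) in_cone_def mult_nonneg_nonneg)
    finally show ?thesis
      using in_cone_mult_eigen_mat[OF cone p l k] W GA by (simp add: mult.assoc)
  next
    case GB
    then have W: "W (g # w) = diag_mat r ** W w" by (simp add: W_def)
    have "W (g # w) $ 1 $ 1 = r * W w $ 1 $ 1"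
      unfolding W by (simp add: diag_mat_def matrix_mult_nth_2)
    also have "\<dots> \<le> r * ?M" using entry_le r by simp
    finally show ?thesis
      using in_cone_mult_diag_mat[OF cone r] W GB by (simp add: mult.left_commute)
  qed
qed

lemma trace_word_mat_eigenbasis:
  fixes X Y :: "real^2^2" and w :: "gen list"
  assumes det: "det X = 1" "det Y = 1" and x: "2 \<le> trace X" and z: "2 < trace (X ** Y)"
  defines "p \<equiv> leading_entry (trace X) (trace Y) (trace (X ** Y))"
    and "l \<equiv> dominant_root (trace X)" and "r \<equiv> dominant_root (trace (X ** Y))"
  shows "trace (word_mat X (X ** Y) w) = trace (word_mat (eigen_mat p l (1 / l)) (diag_mat r) w)"
proof -
  let ?X = "eigen_mat p l (1 / l)" and ?P = "diag_mat r"
  have r: "1 < r" "r + 1 / r = trace (X ** Y)" and l: "1 \<le> l" "l + 1 / l = trace X"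
    using x z
    by (simp_all add: r_def l_def dominant_root_ge_1 dominant_root_gt_1 dominant_root_add_inverse)
  have p: "p * (r - 1 / r) = trace X * r - trace Y"
    using dominant_root_minus_inverse(1)[OF z] by (simp add: p_def leading_entry_def r_def)
  have "trace (X ** (X ** Y)) = trace X * (r + 1 / r) - trace Y"
    using trace_square_mult[OF det(1), of Y] by (simp add: matrix_mul_assoc r(2))
  also have "\<dots> = p * (r - 1 / r) + (l + 1 / l) / r"
    unfolding l(2) p by (simp add: algebra_simps)
  also have "\<dots> = trace (?X ** ?P)"
    by (simp add: trace_2 matrix_mult_nth_2 eigen_mat_def diag_mat_def algebra_simps
        add_divide_distrib diff_divide_distrib)
  finally show ?thesis
    using det r l
    by (intro trace_word_mat_cong)
      (simp_all add: det_mul det_eigen_mat det_diag_mat trace_eigen_mat trace_diag_mat)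
qed

lemma trace_word_mat_mult_left_le:
  fixes X Y :: "real^2^2" and w :: "gen list"
  defines "x \<equiv> trace X" and "y \<equiv> trace Y" and "z \<equiv> trace (X ** Y)"
  defines "M \<equiv> leading_entry x y z ^ count_list w GA * dominant_root z ^ count_list w GB"
  assumes det: "det X = 1" "det Y = 1"
    and x: "2 \<le> x" and z: "2 < z" and "2 * y \<le> x * z" "0 \<le> fricke x y z"
  shows "trace (word_mat X (X ** Y) w) \<le> M + 1 / M"
proof -
  define p l r where "p = leading_entry x y z" and "l = dominant_root x" and "r = dominant_root z"
  have l: "1 \<le> l" and r: "1 \<le> r"
    using x z by (simp_all add: l_def r_def dominant_root_ge_1)
  then have k: "0 \<le> 1 / l" "1 / l \<le> l" "1 / l * l = 1"
    by (simp_all add: field_simps mult_mono[of 1 l 1 l, simplified])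
  have "l \<le> p"
    unfolding l_def p_def using assms by (intro dominant_root_le_leading_entry)
  define W where "W = word_mat (eigen_mat p l (1 / l)) (diag_mat r) w"
  have W: "in_cone W" "W $ 1 $ 1 \<le> M"
    using word_mat_in_cone[OF \<open>l \<le> p\<close> l k r, of w] by (simp_all add: W_def M_def p_def r_def)
  have "trace (word_mat X (X ** Y) w) = trace W"
    using trace_word_mat_eigenbasis[OF det] x z
    by (simp add: W_def p_def l_def r_def x_def y_def z_def)
  also have "\<dots> \<le> W $ 1 $ 1 + 1 / W $ 1 $ 1" by (rule trace_le_in_cone[OF W(1)])
  also have "\<dots> \<le> M + 1 / M"
    using W add_inverse_strict_mono[of "W $ 1 $ 1" M]
    by (cases "W $ 1 $ 1 = M") (simp_all add: in_cone_def)
  finally show ?thesis .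
qed

lemma power_mult_power_strict_mono:
  fixes p q r s :: real
  assumes "0 < p" "0 < r" "p < q" "r \<le> s" "0 < i \<or> r < s \<and> 0 < j"
  shows "p ^ i * r ^ j < q ^ i * s ^ j"
proof (cases "0 < i")
  case True
  have "p ^ i < q ^ i" using assms True by (intro power_strict_mono) auto
  moreover have "r ^ j \<le> s ^ j" using assms by (intro power_mono) auto
  ultimately show ?thesis using assms by (intro mult_less_le_imp_less) auto
next
  case False
  with assms show ?thesis using power_strict_mono[of r s j] by simp
qed

section \<open>Words of maximal trace\<close>

definition weight_maximal :: "real^2^2 \<Rightarrow> real^2^2 \<Rightarrow> nat \<Rightarrow> nat \<Rightarrow> gen list \<Rightarrow> bool" where
  "weight_maximal X Y a b w \<longleftrightarrow>
     (\<forall>u. weight a b u = weight a b w \<longrightarrow> trace (word_mat X Y u) \<le> trace (word_mat X Y w))"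

lemma weight_maximalD:
  "weight_maximal X Y a b w \<Longrightarrow> weight a b u = weight a b w
    \<Longrightarrow> trace (word_mat X Y u) \<le> trace (word_mat X Y w)"
  unfolding weight_maximal_def by blast

lemma weight_maximal_rotation:
  "rotation_of u w \<Longrightarrow> weight_maximal X Y a b w \<Longrightarrow> weight_maximal X Y a b u"
  unfolding weight_maximal_def by (metis rotation_of_weight trace_word_mat_rotation)

lemma weight_maximal_substitute:
  assumes "weight_maximal X Y a b (substitute u v w)"
  shows "weight_maximal (word_mat X Y u) (word_mat X Y v) (weight a b u) (weight a b v) w"
  using assms unfolding weight_maximal_def by (metis weight_substitute word_mat_substitute)

lemma trace_word_mat_wpow:
  fixes X Y :: "real^2^2"
  assumes "det X = 1" "det Y = 1" "2 \<le> trace (word_mat X Y v)"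
  defines "r \<equiv> dominant_root (trace (word_mat X Y v))"
  shows "trace (word_mat X Y (wpow v n)) = r ^ n + 1 / r ^ n"
proof (induction n rule: induct_nat_012)
  case 0
  show ?case by (simp add: trace_I)
next
  case 1
  show ?case using assms by (simp add: dominant_root_add_inverse)
next
  case (ge2 n)
  have r: "0 < r" "trace (word_mat X Y v) = r + 1 / r"
    using assms dominant_root_ge_1[OF assms(3)] by (simp_all add: dominant_root_add_inverse)
  have "trace (word_mat X Y (wpow v (Suc (Suc n))))
    = (r + 1 / r) * trace (word_mat X Y (wpow v (Suc n))) - trace (word_mat X Y (wpow v n))"
    using trace_square_mult[OF det_word_mat[OF assms(1,2)], of v "word_mat X Y (wpow v n)"]
    by (simp add: word_mat_append matrix_mul_assoc flip: r(2))
  moreover have "(r + 1 / r) * (r * s + 1 / (r * s)) - (s + 1 / s) = r * r * s + 1 / (r * r * s)"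
    if "0 < s" for s
    using that r(1) by (simp add: field_simps)
  ultimately show ?case using r(1) ge2 by (simp add: mult.assoc)
qed

lemma weight_maximal_ge_wpow:
  fixes X Y :: "real^2^2" and e :: real
  assumes "det X = 1" "det Y = 1" "2 \<le> trace (word_mat X Y v)"
    and e: "e ^ weight a b v = dominant_root (trace (word_mat X Y v))"
    and w: "weight a b w = weight a b v * n" "weight_maximal X Y a b w"
  shows "e ^ weight a b w + 1 / e ^ weight a b w \<le> trace (word_mat X Y w)"
proof -
  have "weight a b (wpow v n) = weight a b w" by (simp add: weight_wpow w(1))
  with w(2) have "trace (word_mat X Y (wpow v n)) \<le> trace (word_mat X Y w)"
    by (rule weight_maximalD)
  then show ?thesis
    using trace_word_mat_wpow[OF assms(1-3), of n] by (simp add: w(1) power_mult e)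
qed

section \<open>Positive pairs\<close>

locale positive_pair =
  fixes X Y :: "real^2^2"
  assumes det_X: "det X = 1" and det_Y: "det Y = 1"
    and trace_X_ge_2: "2 \<le> trace X" and trace_Y_ge_2: "2 \<le> trace Y"
    and trace_X_le: "trace X \<le> trace (X ** Y)" and trace_Y_le: "trace Y \<le> trace (X ** Y)"
    and trace_commutator_pos: "0 < trace (word_mat X Y (GA # s @ [GB]) ** commutator X Y)"

lemma positive_pairI:
  fixes X Y :: "real^2^2"
  assumes det: "det X = 1" "det Y = 1"
    and ge_2: "2 \<le> trace X" "2 \<le> trace Y" and mult_le: "trace X * trace Y \<le> trace (X ** Y)"
    and trace_pos: "\<And>w. 0 < trace (word_mat X Y w)"
  shows "positive_pair X Y"
proof
  have "trace X \<le> trace X * trace Y" "trace Y \<le> trace X * trace Y"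
    using ge_2 mult_left_mono[of 1 "trace Y" "trace X"] mult_right_mono[of 1 "trace X" "trace Y"]
    by simp_all
  with mult_le show "trace X \<le> trace (X ** Y)" "trace Y \<le> trace (X ** Y)" by simp_all
  fix s
  let ?S = "word_mat X Y s" and ?k = "trace (X ** Y) - trace X * trace Y"
  have "trace (word_mat X Y (GA # s @ [GB]) ** commutator X Y)
      = trace (?S ** (Y ** commutator X Y ** X))"
    using trace_mul_sym[of X "?S ** Y ** commutator X Y"]
    by (simp add: word_mat_append matrix_mul_assoc)
  also have "\<dots> = ?k * trace (?S ** (Y ** X)) + trace (?S ** (X ** X)) + trace (?S ** (Y ** Y))"
    by (simp add: mult_commutator_mult det matrix_add_ldistrib trace_add matrix_scalar_ac
        trace_scaleR flip: scalar_matrix_assoc)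
  also have "\<dots> > 0"
    using trace_pos[of "s @ [GB, GA]"] trace_pos[of "s @ [GA, GA]"] trace_pos[of "s @ [GB, GB]"]
      mult_le by (simp add: word_mat_append add_nonneg_pos)
  finally show "0 < trace (word_mat X Y (GA # s @ [GB]) ** commutator X Y)" .
qed (fact assms)+

context positive_pair
begin

lemma neg_det_commutator_pos: "0 < - det (commutator X Y)"
  using trace_commutator_pos[of "[]"] by (simp flip: trace_mult_commutator)

lemma trace_commutator_neg: "trace (word_mat X Y (GB # s @ [GA]) ** commutator X Y) < 0"
proof -
  let ?w = "GA # rev s @ [GB]"
  obtain d where "trace (word_mat X Y ?w ** commutator X Y) = - d * det (commutator X Y)"
    and "trace (word_mat X Y (rev ?w) ** commutator X Y) = d * det (commutator X Y)"
    using word_mat_rev_difference[OF det_X det_Y, of ?w] by blast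
  with trace_commutator_pos[of "rev s"] show ?thesis by simp
qed

lemma trace_word_mat_reverse_factor_less:
  "trace (word_mat X Y (GA # s @ [GB, GB] @ t @ [GA]))
    < trace (word_mat X Y (GB # rev s @ [GA, GB] @ t @ [GA]))"
proof -
  let ?K = "commutator X Y" let ?v = "GA # s @ [GB]"
  let ?U = "word_mat X Y (GB # t @ [GA])" and ?V = "word_mat X Y ?v" and ?V' = "word_mat X Y (rev ?v)"
  obtain d where diff: "?V - ?V' = d *\<^sub>R ?K" and "trace (?V ** ?K) = - d * det ?K"
    using word_mat_rev_difference[OF det_X det_Y, of ?v] by blast
  with trace_commutator_pos[of s] neg_det_commutator_pos have "0 < d"
    by (simp add: zero_less_mult_iff mult_less_0_iff)
  then have "d * trace (?U ** ?K) < 0"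
    using trace_commutator_neg[of t] by (rule mult_pos_neg)
  also have "d * trace (?U ** ?K) = trace ((?V - ?V') ** ?U)"
    unfolding diff using trace_mul_sym[of ?K ?U] by (simp add: trace_scaleR flip: scalar_matrix_assoc)
  also have "\<dots> = trace (?V ** ?U) - trace (?V' ** ?U)"
    by (simp add: trace_2 matrix_mult_nth_2 algebra_simps)
  finally show ?thesis by (simp add: word_mat_append matrix_mul_assoc)
qed

lemma positive_pair_swap: "positive_pair Y X"
proof
  show "trace Y \<le> trace (Y ** X)" "trace X \<le> trace (Y ** X)"
    using trace_X_le trace_Y_le by (simp_all add: trace_mul_sym[of Y X])
  fix s
  have "word_mat Y X (GA # s @ [GB]) = word_mat X Y (GB # substitute [GB] [GA] s @ [GA])"
    using word_mat_substitute[of X Y "[GB]" "[GA]" "GA # s @ [GB]"] by (simp add: substitute_append)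
  moreover have "commutator Y X = - commutator X Y" by (simp add: commutator_def)
  moreover have "trace (M ** - N) = - trace (M ** N)" for M N :: "real^2^2"
    by (simp add: trace_2 matrix_mult_nth_2)
  ultimately show "0 < trace (word_mat Y X (GA # s @ [GB]) ** commutator Y X)"
    using trace_commutator_neg by simp
qed (fact det_X det_Y trace_X_ge_2 trace_Y_ge_2)+

lemma trace_mult_Y: "trace (X ** Y ** Y) = trace Y * trace (X ** Y) - trace X"
  by (rule trace_mult_square[OF det_Y])

lemma positive_pair_mult: "positive_pair (X ** Y) Y"
proof
  show "det (X ** Y) = 1" by (simp add: det_mul det_X det_Y)
  show "2 \<le> trace (X ** Y)" using trace_X_ge_2 trace_X_le by simp
  have "2 * trace (X ** Y) \<le> trace Y * trace (X ** Y)"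
    using trace_X_ge_2 trace_Y_ge_2 trace_X_le by (intro mult_right_mono) auto
  then show "trace (X ** Y) \<le> trace (X ** Y ** Y)" "trace Y \<le> trace (X ** Y ** Y)"
    using trace_X_le trace_Y_le by (simp_all add: trace_mult_Y)
  fix s
  let ?S = "word_mat (X ** Y) Y s" and ?K = "commutator X Y"
  have "word_mat (X ** Y) Y (GA # s @ [GB]) ** commutator (X ** Y) Y = X ** Y ** ?S ** ?K"
    using mult_commutator_same[OF det_Y, of X]
    by (simp add: word_mat_append commutator_mult_left flip: matrix_mul_assoc)
  also have "X ** Y ** ?S = word_mat X Y (GA # GB # substitute [GA, GB] [GB] s)"
    by (simp add: word_mat_substitute matrix_mul_assoc)
  also have "\<dots> = word_mat X Y (GA # substitute [GB, GA] [GB] s @ [GB])"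
    by (simp only: substitute_AB_B_conjugate)
  finally show "0 < trace (word_mat (X ** Y) Y (GA # s @ [GB]) ** commutator (X ** Y) Y)"
    using trace_commutator_pos by simp
qed (fact det_Y trace_Y_ge_2)+

lemma fricke_pos: "0 < fricke (trace X) (trace Y) (trace (X ** Y))"
  using neg_det_commutator_pos by (simp add: neg_det_commutator[OF det_X det_Y])

lemma trace_mult_gt_2: "2 < trace (X ** Y)"
proof (rule ccontr)
  assume "\<not> 2 < trace (X ** Y)"
  then have "trace X = 2" "trace Y = 2" "trace (X ** Y) = 2"
    using trace_X_ge_2 trace_Y_ge_2 trace_X_le trace_Y_le by linarith+
  with fricke_pos show False by (simp add: fricke_def)
qed

lemma trace_word_mat_mult_left_less:
  fixes e :: real
  defines "r \<equiv> dominant_root (trace (X ** Y))"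
  assumes e: "0 < e" "leading_entry (trace X) (trace Y) (trace (X ** Y)) < e ^ a" "r \<le> e ^ b"
    and w: "0 < count_list w GA \<or> r < e ^ b \<and> 0 < count_list w GB"
  shows "trace (word_mat X (X ** Y) w) < e ^ weight a b w + 1 / e ^ weight a b w"
proof -
  let ?p = "leading_entry (trace X) (trace Y) (trace (X ** Y))"
  define M where "M = ?p ^ count_list w GA * r ^ count_list w GB"
  have double_trace_Y_le: "2 * trace Y \<le> trace X * trace (X ** Y)"
    using trace_X_ge_2 trace_Y_ge_2 trace_Y_le by (intro mult_mono) auto
  have "1 \<le> ?p"
    using dominant_root_le_leading_entry[OF trace_X_ge_2 trace_mult_gt_2 double_trace_Y_le] fricke_pos
      dominant_root_ge_1[OF trace_X_ge_2] by simp
  have "1 < r" unfolding r_def by (rule dominant_root_gt_1[OF trace_mult_gt_2])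
  have "1 * 1 \<le> M"
    unfolding M_def using \<open>1 \<le> ?p\<close> \<open>1 < r\<close> by (intro mult_mono one_le_power) auto
  have "M < (e ^ a) ^ count_list w GA * (e ^ b) ^ count_list w GB"
    unfolding M_def using \<open>1 \<le> ?p\<close> \<open>1 < r\<close> e w by (intro power_mult_power_strict_mono) auto
  also have "\<dots> = e ^ weight a b w" by (simp add: weight_def power_add power_mult)
  finally have "M + 1 / M < e ^ weight a b w + 1 / e ^ weight a b w"
    using \<open>1 * 1 \<le> M\<close> by (intro add_inverse_strict_mono) auto
  moreover have "trace (word_mat X (X ** Y) w) \<le> M + 1 / M"
    unfolding M_def r_def using trace_word_mat_mult_left_le[OF det_X det_Y trace_X_ge_2 trace_mult_gt_2]
      double_trace_Y_le fricke_pos by simp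
  ultimately show ?thesis by simp
qed

lemma trace_word_mat_mult_right_less:
  fixes e :: real
  defines "r \<equiv> dominant_root (trace (X ** Y))"
  assumes e: "0 < e" "leading_entry (trace Y) (trace X) (trace (X ** Y)) < e ^ b" "r \<le> e ^ a"
    and w: "0 < count_list w GB \<or> r < e ^ a \<and> 0 < count_list w GA"
  shows "trace (word_mat (X ** Y) Y w) < e ^ weight a b w + 1 / e ^ weight a b w"
proof -
  interpret swap: positive_pair Y X by (rule positive_pair_swap)
  let ?w = "substitute [GB] [GA] w"
  have trace_YX: "trace (Y ** X) = trace (X ** Y)" by (rule trace_mul_sym)
  have "trace (word_mat (X ** Y) Y w) = trace (word_mat (Y ** X) Y w)"
    using trace_mul_sym[of "Y ** X" Y] trace_mul_sym[of "X ** Y" Y]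
    by (intro trace_word_mat_cong) (simp_all add: det_mul det_X det_Y trace_YX matrix_mul_assoc)
  also have "\<dots> = trace (word_mat Y (Y ** X) ?w)"
    by (simp add: word_mat_substitute)
  also have "count_list ?w GA = count_list w GB \<and> count_list ?w GB = count_list w GA"
    using weight_substitute[of 1 0 "[GB]" "[GA]" w] weight_substitute[of 0 1 "[GB]" "[GA]" w]
    by (simp add: weight_def)
  then have "trace (word_mat Y (Y ** X) ?w) < e ^ weight b a ?w + 1 / e ^ weight b a ?w"
    using e w by (intro swap.trace_word_mat_mult_left_less) (simp_all add: trace_YX r_def)
  finally show ?thesis by (simp add: weight_substitute)
qed

lemma not_weight_maximal_AA_BB:
  assumes "weight_maximal X Y a b w"
  shows "\<not> rotation_of (GA # s @ [GB, GB] @ t @ [GA]) w"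
proof
  let ?v = "GA # s @ [GB, GB] @ t @ [GA]"
  assume "rotation_of ?v w"
  with assms have "weight_maximal X Y a b ?v"
    by (rule weight_maximal_rotation[rotated])
  then have "trace (word_mat X Y (GB # rev s @ [GA, GB] @ t @ [GA])) \<le> trace (word_mat X Y ?v)"
    by (rule weight_maximalD) simp
  with trace_word_mat_reverse_factor_less[of s t] show False by simp
qed

lemma trace_word_mat_less_if_A_AB:
  fixes e :: real
  defines "r \<equiv> dominant_root (trace (X ** Y))"
  assumes rot: "rotation_of (substitute [GA] [GA, GB] u) w"
    and "0 < e" "leading_entry (trace X) (trace Y) (trace (X ** Y)) < e ^ a" "r \<le> e ^ (a + b)"
    and "0 < count_list u GA \<or> r < e ^ (a + b) \<and> 0 < count_list u GB"
  shows "trace (word_mat X Y w) < e ^ weight a b w + 1 / e ^ weight a b w"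
proof -
  have "trace (word_mat X Y w) = trace (word_mat X (X ** Y) u)"
    using trace_word_mat_rotation[OF rot, of X Y] by (simp add: word_mat_substitute)
  also have "\<dots> < e ^ weight a (a + b) u + 1 / e ^ weight a (a + b) u"
    using assms unfolding r_def by (intro trace_word_mat_mult_left_less)
  also have "weight a (a + b) u = weight a b w"
    using rotation_of_weight[OF rot, of a b] by (simp add: weight_substitute)
  finally show ?thesis .
qed

lemma trace_word_mat_less_if_AB_B:
  fixes e :: real
  defines "r \<equiv> dominant_root (trace (X ** Y))"
  assumes rot: "rotation_of (substitute [GA, GB] [GB] u) w"
    and "0 < e" "leading_entry (trace Y) (trace X) (trace (X ** Y)) < e ^ b" "r \<le> e ^ (a + b)"
    and "0 < count_list u GB \<or> r < e ^ (a + b) \<and> 0 < count_list u GA"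
  shows "trace (word_mat X Y w) < e ^ weight a b w + 1 / e ^ weight a b w"
proof -
  have "trace (word_mat X Y w) = trace (word_mat (X ** Y) Y u)"
    using trace_word_mat_rotation[OF rot, of X Y] by (simp add: word_mat_substitute)
  also have "\<dots> < e ^ weight (a + b) b u + 1 / e ^ weight (a + b) b u"
    using assms unfolding r_def by (intro trace_word_mat_mult_right_less)
  also have "weight (a + b) b u = weight a b w"
    using rotation_of_weight[OF rot, of a b] by (simp add: weight_substitute)
  finally show ?thesis .
qed

lemma weight_maximal_AB:
  fixes e :: real
  defines "x \<equiv> trace X" and "y \<equiv> trace Y" and "z \<equiv> trace (X ** Y)"
  assumes e: "0 < e" "e ^ (a + b) = dominant_root z"
    and leading: "leading_entry x y z < e ^ a" "leading_entry y x z < e ^ b"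
    and w: "weight a b w = (a + b) * n" "weight_maximal X Y a b w" and "0 < a + b"
  shows "rotation_of w (wpow [GA, GB] n)"
proof -
  have trace_ge: "e ^ weight a b w + 1 / e ^ weight a b w \<le> trace (word_mat X Y w)"
    using w e(2) trace_mult_gt_2
    by (intro weight_maximal_ge_wpow[OF det_X det_Y, where v = "[GA, GB]" and n = n]) (simp_all add: z_def)
  show ?thesis
  proof (cases w rule: rotation_cases)
    case (A_AB u)
    have "count_list u GA = 0"
      using trace_word_mat_less_if_A_AB[OF A_AB e(1), of a b] leading(1) e(2) trace_ge
      by (fastforce simp: x_def y_def z_def)
    moreover from this have "count_list u GB = n"
      using rotation_of_weight[OF A_AB, of a b, unfolded weight_substitute] w(1) \<open>0 < a + b\<close>
      by (auto simp: weight_def)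
    ultimately have "substitute [GA] [GA, GB] u = wpow [GA, GB] n"
      by (simp add: substitute_eq_wpow_right)
    with A_AB show ?thesis by (simp add: rotation_of_sym)
  next
    case (AB_B u)
    have "count_list u GB = 0"
      using trace_word_mat_less_if_AB_B[OF AB_B e(1), of b a] leading(2) e(2) trace_ge
      by (fastforce simp: x_def y_def z_def)
    moreover from this have "count_list u GA = n"
      using rotation_of_weight[OF AB_B, of a b, unfolded weight_substitute] w(1) \<open>0 < a + b\<close>
      by (auto simp: weight_def)
    ultimately have "substitute [GA, GB] [GB] u = wpow [GA, GB] n"
      by (simp add: substitute_eq_wpow_left)
    with AB_B show ?thesis by (simp add: rotation_of_sym)
  next
    case (AA_BB s t)
    with not_weight_maximal_AA_BB[OF w(2)] show ?thesis by blast
  qed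
qed

lemma weight_maximal_ABB:
  fixes e :: real
  defines "x \<equiv> trace X" and "y \<equiv> trace Y" and "z \<equiv> trace (X ** Y)" and "d \<equiv> trace (X ** Y ** Y)"
  assumes e: "0 < e" "e ^ (a + 2 * b) = dominant_root d" "dominant_root z < e ^ (a + b)"
    and leading: "leading_entry x y z < e ^ a" "leading_entry z y d < e ^ (a + b)"
      "leading_entry y z d < e ^ b"
    and w: "weight a b w = (a + 2 * b) * n" "weight_maximal X Y a b w" and "0 < a + b" and "w \<noteq> []"
  shows "rotation_of w (wpow [GA, GB, GB] n)"
proof (cases w rule: rotation_cases)
  interpret mult: positive_pair "X ** Y" Y by (rule positive_pair_mult)
  case (A_AB u)
  have "e ^ weight a b w + 1 / e ^ weight a b w \<le> trace (word_mat X Y w)"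
    using w e(2) mult.trace_mult_gt_2
    by (intro weight_maximal_ge_wpow[OF det_X det_Y, where v = "[GA, GB, GB]" and n = n])
      (simp_all add: d_def matrix_mul_assoc add.assoc mult_2)
  moreover have "u \<noteq> []"
    using A_AB \<open>w \<noteq> []\<close> by (metis rotate_is_Nil_conv rotation_of_def substitute.simps(1))
  then have "0 < count_list u GA \<or> 0 < count_list u GB"
    by (cases u; cases "hd u") simp_all
  ultimately show ?thesis
    using trace_word_mat_less_if_A_AB[OF A_AB e(1), of a b] leading(1) e(3)
    by (fastforce simp: x_def y_def z_def)
next
  interpret mult: positive_pair "X ** Y" Y by (rule positive_pair_mult)
  case (AB_B v)
  have "weight_maximal (X ** Y) Y (a + b) b v"
    using weight_maximal_substitute[OF weight_maximal_rotation[OF AB_B w(2)]] by simp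
  moreover have "weight (a + b) b v = weight a b w"
    using rotation_of_weight[OF AB_B, of a b] by (simp add: weight_substitute)
  ultimately have "rotation_of v (wpow [GA, GB] n)"
    using e leading(2,3) w(1) \<open>0 < a + b\<close>
    by (intro mult.weight_maximal_AB[of e "a + b" b])
      (simp_all add: x_def y_def z_def d_def add.assoc mult_2)
  then have "rotation_of (substitute [GA, GB] [GB] v) (wpow [GA, GB, GB] n)"
    using rotation_of_substitute[of v "wpow [GA, GB] n" "[GA, GB]" "[GB]"] by (simp add: substitute_wpow)
  with AB_B show ?thesis
    using rotation_of_sym rotation_of_trans by blast
next
  case (AA_BB s t)
  with not_weight_maximal_AA_BB[OF w(2)] show ?thesis by blast
qed

end

section \<open>Estimates\<close>

text \<open>For the traces \<open>x, y, z\<close> of \<open>A, B, AB\<close>,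
  \<open>tr((AB)\<^sup>3) - tr((AB\<^sup>2)\<^sup>2) = z trace_gap x y z + z + 2 - x\<^sup>2\<close>.\<close>

definition trace_gap :: "'a::comm_ring_1 \<Rightarrow> 'a \<Rightarrow> 'a \<Rightarrow> 'a" where
  "trace_gap x y z = z\<^sup>2 - 4 - y\<^sup>2 * z + 2 * x * y"

lemma leading_entry_less_sqrt:
  assumes "2 < z" "0 \<le> x" "x < y" and gap: "0 \<le> trace_gap x y z"
  shows "leading_entry y x z < sqrt (dominant_root z)"
proof -
  define r where "r = dominant_root z"
  define D where "D = r - 1 / r"
  have r: "1 < r" "r + 1 / r = z"
    using assms(1) by (simp_all add: r_def dominant_root_gt_1 dominant_root_add_inverse)
  have D: "0 < D" "D\<^sup>2 = z\<^sup>2 - 4"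
    using dominant_root_minus_inverse[OF assms(1)] by (simp_all add: D_def r_def)
  have "r\<^sup>2 = z * r - 1" using r(1) by (simp add: field_simps power2_eq_square flip: r(2))
  then have "r * D\<^sup>2 - (y * r - x)\<^sup>2 = r * trace_gap x y z + (y\<^sup>2 - x\<^sup>2)"
    unfolding D trace_gap_def by algebra
  moreover have "x\<^sup>2 < y\<^sup>2" using assms by (intro power_strict_mono) auto
  moreover have "0 \<le> r * trace_gap x y z" using gap r(1) by simp
  ultimately have "(y * r - x)\<^sup>2 < (sqrt r * D)\<^sup>2"
    using r(1) by (simp add: power_mult_distrib)
  then have "y * r - x < sqrt r * D"
    by (rule power2_less_imp_less) (use D(1) r(1) in simp)
  then show ?thesis using leading_entry_less_iff[OF assms(1)] by (simp add: D_def r_def)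
qed

lemma leading_entry_swap_le:
  assumes "2 < z" "x \<le> y"
  shows "leading_entry x y z \<le> leading_entry y x z"
proof -
  let ?r = "dominant_root z"
  have "0 \<le> (y - x) * (?r + 1)" using assms dominant_root_gt_1[of z] by simp
  then have "x * ?r - y \<le> y * ?r - x" by (simp add: algebra_simps)
  then show ?thesis
    unfolding leading_entry_def using dominant_root_minus_inverse(1)[OF assms(1)]
    by (intro divide_right_mono) auto
qed

lemma dominant_root_less:
  assumes "2 \<le> s"
  shows "dominant_root s < s - 1 / s"
proof -
  let ?r = "dominant_root s"
  have r: "1 \<le> ?r" "?r + 1 / ?r = s"
    using assms by (simp_all add: dominant_root_ge_1 dominant_root_add_inverse)
  moreover from r(1) have "0 < 1 / ?r" by simp
  ultimately have "?r < s" by linarith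
  then have "1 / s < 1 / ?r" using r(1) by (intro divide_strict_left_mono) auto
  with r(2) show ?thesis by linarith
qed

lemma dominant_root_ge:
  assumes "2 \<le> s"
  shows "s - 1 \<le> dominant_root s"
proof -
  have "1 / dominant_root s \<le> 1" using dominant_root_ge_1[OF assms] by simp
  with dominant_root_add_inverse[OF assms] show ?thesis by linarith
qed

lemma leading_entry_less:
  assumes "2 < z" "x \<le> z - 1" "0 < s" "1 + s * z \<le> y"
  shows "leading_entry x y z < x - s"
proof -
  let ?r = "dominant_root z"
  have r: "1 < ?r" "?r + 1 / ?r = z"
    using assms(1) by (simp_all add: dominant_root_gt_1 dominant_root_add_inverse)
  have "x / ?r \<le> 1" using dominant_root_ge[of z] assms r(1) by simp
  moreover have "0 < s * (1 / ?r)" using assms(3) r(1) by simp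
  moreover have "s * z = s * ?r + s * (1 / ?r)"
    using distrib_left[of s ?r "1 / ?r"] unfolding r(2) .
  ultimately have "x / ?r + s * ?r - s * (1 / ?r) < y" using assms(4) by linarith
  then show ?thesis
    unfolding leading_entry_less_iff[OF assms(1)] by (simp add: algebra_simps diff_divide_distrib)
qed

context
  fixes x y z d e :: real
  assumes x: "2 \<le> x" "2 * x \<le> y" and z: "z = y\<^sup>2 - 1" and d: "d = y * z - x"
    and e: "0 < e" "e ^ 3 = dominant_root d"
begin

lemma trace_bounds:
  "4 \<le> y" "15 \<le> z" "x \<le> z - 1" "2 < d" "y \<le> d - 1" "z \<le> d - 1" "1 / (2 * z) \<le> 1 / 30"
proof -
  show y: "4 \<le> y" using x by simp
  show z_ge: "15 \<le> z" using power_mono[of 4 y 2] y z by simp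
  have "y * 4 \<le> y * y" using y by (intro mult_left_mono) auto
  then have "y \<le> z" using y unfolding z power2_eq_square by linarith
  then show "x \<le> z - 1" using x by linarith
  have "4 * z \<le> y * z" using y z_ge by (intro mult_right_mono) auto
  then show "2 < d" "y \<le> d - 1" "z \<le> d - 1" using x z_ge \<open>y \<le> z\<close> unfolding d by linarith+
  show "1 / (2 * z) \<le> 1 / 30" using z_ge by (simp add: field_simps)
qed

text \<open>All growth rates are compared with \<open>z - 1/(2z)\<close>, which separates \<open>e\<^sup>2\<close> (about \<open>z - 1/(4z)\<close>
  in the worst case \<open>2x = y\<close>) from the others (about \<open>z - 1/z\<close> on the same scale).\<close>

lemma cube_le_trace_square: "(z - 1 / (2 * z)) ^ 3 \<le> d\<^sup>2 - 3"
proof -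
  have z_pos: "0 < z" using trace_bounds(2) by simp
  have "(z - 1 / (2 * z)) ^ 3 = z ^ 3 - 3 / 2 * z + 3 / 2 * (1 / (2 * z)) - (1 / (2 * z)) ^ 3"
    using z_pos by (simp add: field_simps power3_eq_cube)
  moreover have "0 < (1 / (2 * z)) ^ 3" using z_pos by simp
  ultimately have "(z - 1 / (2 * z)) ^ 3 \<le> z ^ 3 - 3 / 2 * z + 1" using trace_bounds(7) by linarith
  also have "\<dots> \<le> y\<^sup>2 * (z - 1 / 2)\<^sup>2 - 3"
  proof -
    have "y\<^sup>2 = z + 1" using z by simp
    then have "y\<^sup>2 * (z - 1 / 2)\<^sup>2 = z ^ 3 - 3 / 4 * z + 1 / 4"
      by (simp add: field_simps power2_eq_square power3_eq_cube)
    with trace_bounds(2) show ?thesis by linarith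
  qed
  also have "\<dots> \<le> d\<^sup>2 - 3"
  proof -
    have "(y * (z - 1 / 2))\<^sup>2 \<le> d\<^sup>2"
      unfolding d using x trace_bounds(2) by (intro power_mono) (simp_all add: algebra_simps)
    then show ?thesis by (simp add: power_mult_distrib)
  qed
  finally show ?thesis .
qed

lemma growth_square_ge: "z - 1 / (2 * z) \<le> e\<^sup>2"
proof -
  define r where "r = dominant_root d"
  have r: "1 < r" "r + 1 / r = d"
    using trace_bounds(4) by (simp_all add: r_def dominant_root_gt_1 dominant_root_add_inverse)
  then have "(1 / r)\<^sup>2 \<le> 1" by (simp add: power_le_one)
  moreover have "d\<^sup>2 = r\<^sup>2 + 2 + (1 / r)\<^sup>2"
    using r(1) by (simp add: power2_sum flip: r(2))
  ultimately have "(z - 1 / (2 * z)) ^ 3 \<le> r\<^sup>2" using cube_le_trace_square by simp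
  also have "r\<^sup>2 = (e\<^sup>2) ^ 3" unfolding r_def e(2)[symmetric] by (metis power_mult mult.commute)
  finally show ?thesis by (rule power_le_imp_le_base[of _ 2, simplified]) simp
qed

lemma less_growthI: "s\<^sup>2 < z - 1 / (2 * z) \<Longrightarrow> s < e"
  using growth_square_ge e(1) by (meson order_less_le_trans less_imp_le power2_less_imp_less)

lemma dominant_root_less_growth_square: "dominant_root z < e\<^sup>2"
proof -
  have "dominant_root z < z - 1 / z" using trace_bounds(2) by (intro dominant_root_less) simp
  also have "\<dots> \<le> z - 1 / (2 * z)" using trace_bounds(2) by (simp add: field_simps)
  finally show ?thesis using growth_square_ge by linarith
qed

lemma leading_entry_A_less_growth: "leading_entry x y z < e"
proof -
  have "leading_entry x y z < x - 1 / z"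
    using trace_bounds by (intro leading_entry_less) simp_all
  also have "\<dots> < x" using trace_bounds(2) by simp
  also have "x < e"
  proof (rule less_growthI)
    have "(2 * x)\<^sup>2 \<le> y\<^sup>2" using x by (intro power_mono) auto
    then have "4 * x\<^sup>2 \<le> z + 1" using z by (simp add: power_mult_distrib)
    then show "x\<^sup>2 < z - 1 / (2 * z)" using trace_bounds(2,7) by linarith
  qed
  finally show ?thesis .
qed

lemma leading_entry_B_less_growth: "leading_entry y z d < e"
proof -
  have "3 / (4 * y) * d \<le> 3 / (4 * y) * (y * z)"
    unfolding d using x trace_bounds(1) by (intro mult_left_mono) auto
  then have "leading_entry y z d < y - 3 / (4 * y)"
    using trace_bounds by (intro leading_entry_less) simp_all
  also have "\<dots> < e"
  proof (rule less_growthI)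
    have "(y - 3 / (4 * y))\<^sup>2 = y\<^sup>2 - 3 / 2 + 9 / 16 * (1 / y\<^sup>2)"
      using trace_bounds(1) by (simp add: field_simps power2_eq_square)
    moreover have "1 / y\<^sup>2 \<le> 1 / 16"
      using z trace_bounds(2) by (intro divide_left_mono) auto
    ultimately show "(y - 3 / (4 * y))\<^sup>2 < z - 1 / (2 * z)" using trace_bounds(7) z by linarith
  qed
  finally show ?thesis .
qed

lemma leading_entry_AB_less_growth_square: "leading_entry z y d < e\<^sup>2"
proof -
  have "1 / (2 * z) * d \<le> 1 / (2 * z) * (y * z)"
    unfolding d using x trace_bounds(2) by (intro mult_left_mono) auto
  then have "leading_entry z y d < z - 1 / (2 * z)"
    using trace_bounds by (intro leading_entry_less) simp_all
  with growth_square_ge show ?thesis by simp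
qed

end

text \<open>Integrality enters here: a negative \<open>trace_gap\<close> is at most \<open>-1\<close>, which outweighs the term \<open>z\<close>.\<close>

lemma trace_gap_nonneg_iff:
  fixes x y z :: int
  assumes "2 \<le> x" "x < y" "y\<^sup>2 - 2 < z"
  shows "(y * z - x)\<^sup>2 - 2 < z ^ 3 - 3 * z \<longleftrightarrow> 0 \<le> trace_gap x y z"
proof -
  have "4 \<le> x\<^sup>2" using power_mono[of 2 x 2] assms(1) by simp
  moreover have "x\<^sup>2 < y\<^sup>2" using assms(1,2) by (intro power_strict_mono) auto
  ultimately have "4 \<le> x\<^sup>2" "x\<^sup>2 \<le> z" "0 < z" using assms(3) by simp_all
  have diff: "z ^ 3 - 3 * z - ((y * z - x)\<^sup>2 - 2) = z * trace_gap x y z + z + 2 - x\<^sup>2"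
    by (simp add: trace_gap_def algebra_simps power2_eq_square power3_eq_cube)
  show ?thesis
  proof
    assume "(y * z - x)\<^sup>2 - 2 < z ^ 3 - 3 * z"
    with diff \<open>4 \<le> x\<^sup>2\<close> have "- z < z * trace_gap x y z" by linarith
    then have "z * (- 1) < z * trace_gap x y z" by simp
    with \<open>0 < z\<close> show "0 \<le> trace_gap x y z" by (simp only: mult_less_cancel_left_pos)
  next
    assume "0 \<le> trace_gap x y z"
    then have "0 \<le> z * trace_gap x y z" using \<open>0 < z\<close> by (intro mult_nonneg_nonneg) auto
    with diff \<open>x\<^sup>2 \<le> z\<close> show "(y * z - x)\<^sup>2 - 2 < z ^ 3 - 3 * z" by linarith
  qed
qed

lemma trace_gap_neg:
  fixes x y z :: int
  assumes "2 \<le> x" "x < y" "y\<^sup>2 - 2 < z" and neg: "trace_gap x y z < 0"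
  shows "z = y\<^sup>2 - 1" "2 * x \<le> y"
proof -
  have "2 * 2 \<le> x * y" using assms by (intro mult_mono) auto
  show z: "z = y\<^sup>2 - 1"
  proof (rule ccontr)
    assume "z \<noteq> y\<^sup>2 - 1"
    with assms(3) have "y\<^sup>2 \<le> z" by simp
    then have "0 \<le> z * (z - y\<^sup>2)"
      by (intro mult_nonneg_nonneg) (auto intro: order_trans[OF zero_le_power2])
    with neg \<open>2 * 2 \<le> x * y\<close> show False
      by (simp add: trace_gap_def algebra_simps power2_eq_square)
  qed
  show "2 * x \<le> y"
  proof (rule ccontr)
    assume "\<not> 2 * x \<le> y"
    then have "(y + 1) * y \<le> 2 * x * y" using assms by (intro mult_right_mono) auto
    with neg assms(1,2) show False
      by (simp add: trace_gap_def z algebra_simps power2_eq_square)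
  qed
qed

section \<open>Optimal words\<close>

abbreviation real_matrix :: "int^'n^'m \<Rightarrow> real^'n^'m" where
  "real_matrix \<equiv> map_matrix real_of_int"

lemma real_matrix_mult: "real_matrix (A ** B) = real_matrix A ** real_matrix B"
  by (simp add: vec_eq_iff matrix_matrix_mult_def)

lemma real_matrix_one: "real_matrix (mat 1) = mat 1"
  by (simp add: vec_eq_iff mat_def)

lemma trace_real_matrix: "trace (real_matrix A) = real_of_int (trace A)"
  by (simp add: trace_def)

lemma det_real_matrix: "det (real_matrix A) = real_of_int (det A)"
  by (simp add: det_def)

lemma real_matrix_word_mat:
  "real_matrix (word_mat A B w) = word_mat (real_matrix A) (real_matrix B) w"
  by (induction A B w rule: word_mat.induct) (simp_all add: real_matrix_mult real_matrix_one)

lemma phi_eq_word_mat: "phi A B w = word_mat A B w"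
  by (induction A B w rule: word_mat.induct) (simp_all add: phi_def)

lemma maximal_word_iff:
  "maximal_word A B w \<longleftrightarrow> w \<noteq> [] \<and> (\<forall>u. u \<noteq> [] \<longrightarrow>
     trace (word_mat (real_matrix A) (real_matrix B) (wpow u (length w)))
     \<le> trace (word_mat (real_matrix A) (real_matrix B) (wpow w (length u))))"
  by (simp add: maximal_word_def wle_def wtr_def phi_eq_word_mat trace_real_matrix
      flip: real_matrix_word_mat)

lemma SL2_nonneg_mult:
  assumes "SL2_nonneg A" "SL2_nonneg B"
  shows "SL2_nonneg (A ** B)"
  using assms by (simp add: SL2_nonneg_def det_mul matrix_mult_nth_2)

lemma SL2_nonneg_word_mat: "SL2_nonneg A \<Longrightarrow> SL2_nonneg B \<Longrightarrow> SL2_nonneg (word_mat A B w)"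
proof (induction A B w rule: word_mat.induct)
  case (1 A B)
  have "0 \<le> (mat 1 :: imat)$i$j" for i j by (simp add: mat_def)
  then show ?case by (simp add: SL2_nonneg_def)
qed (simp_all add: SL2_nonneg_mult)

lemma SL2_nonneg_trace_ge_2:
  assumes "SL2_nonneg A"
  shows "2 \<le> trace A"
proof -
  have nonneg: "0 \<le> A$1$1" "0 \<le> A$2$2" "0 \<le> A$1$2 * A$2$1"
    using assms by (simp_all add: SL2_nonneg_def)
  moreover have "A$1$1 * A$2$2 = 1 + A$1$2 * A$2$1"
    using assms by (simp add: SL2_nonneg_def det_2)
  ultimately have "0 < A$1$1 * A$2$2" by simp
  with nonneg have "0 < A$1$1" "0 < A$2$2" by (auto simp: zero_less_mult_iff)
  then show ?thesis by (simp add: trace_2)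
qed

lemma positive_pair_real_matrix:
  assumes "SL2_nonneg A" "SL2_nonneg B" "trace A * trace B \<le> trace (A ** B)"
  shows "positive_pair (real_matrix A) (real_matrix B)"
proof (rule positive_pairI)
  show "det (real_matrix A) = 1" "det (real_matrix B) = 1"
    using assms by (simp_all add: det_real_matrix SL2_nonneg_def)
  show "2 \<le> trace (real_matrix A)" "2 \<le> trace (real_matrix B)"
    using assms SL2_nonneg_trace_ge_2 by (fastforce simp: trace_real_matrix)+
  show "trace (real_matrix A) * trace (real_matrix B) \<le> trace (real_matrix A ** real_matrix B)"
    using assms(3) by (simp add: trace_real_matrix flip: real_matrix_mult of_int_mult)
  show "0 < trace (word_mat (real_matrix A) (real_matrix B) w)" for w
    using SL2_nonneg_trace_ge_2[OF SL2_nonneg_word_mat[OF assms(1,2), of w]]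
    by (simp add: trace_real_matrix flip: real_matrix_word_mat)
qed

lemma ex_weight_maximal:
  obtains w where "length w = n" "weight_maximal X Y 1 1 w"
proof -
  let ?S = "{w :: gen list. length w = n}" and ?tr = "\<lambda>w. trace (word_mat X Y w)"
  have "(UNIV :: gen set) = {GA, GB}" using gen.exhaust by auto
  then have "finite (UNIV :: gen set)" by (metis finite.emptyI finite.insertI)
  then have "finite ?S" using finite_lists_length_eq[of UNIV n] by simp
  moreover have "?S \<noteq> {}" using Ex_list_of_length[of n] by blast
  ultimately have "Max (?tr ` ?S) \<in> ?tr ` ?S" "\<And>u. u \<in> ?S \<Longrightarrow> ?tr u \<le> Max (?tr ` ?S)"
    by simp_all
  then obtain w where "length w = n" "\<And>u. length u = n \<Longrightarrow> ?tr u \<le> ?tr w" by auto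
  with that show thesis unfolding weight_maximal_def weight_1_1 by blast
qed

lemma rotate_wpow: "rotate k (wpow w n) = wpow (rotate k w) n"
proof (induction k)
  case (Suc k)
  have "rotate1 (wpow u n) = wpow (rotate1 u) n" for u :: "gen list"
  proof (cases u)
    case (Cons g s)
    have "wpow (g # s) n @ [g] = g # wpow (s @ [g]) n"
      by (induction n) simp_all
    then show ?thesis using Cons by (cases n) simp_all
  qed (simp add: wpow_def)
  with Suc show ?case by simp
qed simp

lemma wpow_add: "wpow w (m + n) = wpow w m @ wpow w n"
  by (induction m) simp_all

lemma lyndon_rotate_eq_imp_dvd:
  assumes "lyndon v" "rotate k v = v"
  shows "length v dvd k"
proof (rule ccontr)
  assume "\<not> length v dvd k"
  moreover have "v \<noteq> []" using assms(1) by (simp add: lyndon_def)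
  ultimately have "0 < k mod length v" "k mod length v < length v"
    by (simp_all add: mod_greater_zero_iff_not_dvd)
  with assms(1) have "lex_less v (rotate (k mod length v) v)" by (simp add: lyndon_def)
  with assms(2) show False
    by (auto simp: lex_less_def simp flip: rotate_conv_mod)
qed

lemma lyndon_wpow_root:
  assumes "lyndon v" and powers_eq: "wpow u m = wpow v l" and "0 < m" "0 < l"
  obtains n where "u = wpow v n"
proof -
  have "wpow (rotate (length u) v) l = wpow v l"
    by (simp flip: powers_eq rotate_wpow) (simp add: rotate_wpow)
  with \<open>0 < l\<close> have "rotate (length u) v = v" by (cases l) simp_all
  with \<open>lyndon v\<close> obtain n where n: "length u = n * length v"
    using lyndon_rotate_eq_imp_dvd by (metis dvd_def mult.commute)
  have "v \<noteq> []" using assms(1) by (simp add: lyndon_def)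
  moreover have "m * n * length v = l * length v" using powers_eq n by (metis length_wpow mult.assoc)
  ultimately have "l = n + (m - 1) * n" using \<open>0 < m\<close> by (cases m) simp_all
  then have "wpow v n = take (length u) (wpow u m)"
    by (simp add: powers_eq wpow_add n length_wpow)
  also have "\<dots> = u" using \<open>0 < m\<close> by (cases m) simp_all
  finally show thesis using that by metis
qed

lemma lyndon_rotation_of_wpow_root:
  assumes "lyndon v" "rotation_of (wpow w m) (wpow v l)" "0 < m" "0 < l"
  obtains k n where "w = wpow (rotate k v) n"
proof -
  obtain i where "wpow v l = wpow (rotate i w) m"
    using rotation_of_sym[OF assms(2)] unfolding rotation_of_def by (metis rotate_wpow)
  then obtain n where "rotate i w = wpow v n"
    using lyndon_wpow_root[OF assms(1), of "rotate i w" m l] assms(3,4) by auto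
  with that show thesis
    using rotation_of_sym unfolding rotation_of_def by (metis rotate_wpow)
qed

lemma maximal_wordI:
  assumes "v \<noteq> []"
    and "\<And>n. 0 < n \<Longrightarrow> weight_maximal (real_matrix A) (real_matrix B) 1 1 (wpow v n)"
  shows "maximal_word A B v"
  unfolding maximal_word_iff using assms
  by (auto intro!: weight_maximalD[of _ _ 1 1] simp: weight_1_1 length_wpow)

lemma maximal_word_imp_weight_maximal:
  assumes "maximal_word A B w" "v \<noteq> []"
    and "weight_maximal (real_matrix A) (real_matrix B) 1 1 (wpow v (length w))"
  shows "weight_maximal (real_matrix A) (real_matrix B) 1 1 (wpow w (length v))"
proof -
  have "trace (word_mat (real_matrix A) (real_matrix B) (wpow v (length w)))
      \<le> trace (word_mat (real_matrix A) (real_matrix B) (wpow w (length v)))"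
    using assms(1,2) by (simp add: maximal_word_iff)
  with assms(3) show ?thesis
    unfolding weight_maximal_def weight_1_1 by (force simp: length_wpow mult.commute)
qed

lemma complete_optimalI:
  assumes lyndon: "lyndon v"
    and maximal_imp_rotation: "\<And>n w. 0 < n \<Longrightarrow> length w = length v * n
      \<Longrightarrow> weight_maximal (real_matrix A) (real_matrix B) 1 1 w \<Longrightarrow> rotation_of w (wpow v n)"
  shows "complete_optimal A B {v}"
proof -
  have v: "v \<noteq> []" using lyndon by (simp add: lyndon_def)
  have maximal_wpow: "weight_maximal (real_matrix A) (real_matrix B) 1 1 (wpow v n)" if "0 < n" for n
  proof -
    obtain w where "length w = length v * n" "weight_maximal (real_matrix A) (real_matrix B) 1 1 w"
      by (rule ex_weight_maximal)
    with maximal_imp_rotation[OF that] show ?thesis using rotation_of_sym weight_maximal_rotation by blast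
  qed
  have "\<exists>k n. n \<ge> 1 \<and> w = wpow (rotate k v) n" if w: "maximal_word A B w" for w
  proof -
    have "w \<noteq> []" using w by (simp add: maximal_word_iff)
    then have "rotation_of (wpow w (length v)) (wpow v (length w))"
      using maximal_word_imp_weight_maximal[OF w v maximal_wpow]
      by (intro maximal_imp_rotation) (simp_all add: length_wpow)
    then obtain k n where k: "w = wpow (rotate k v) n"
      using lyndon_rotation_of_wpow_root[OF lyndon] v \<open>w \<noteq> []\<close> by (metis length_greater_0_conv)
    with \<open>w \<noteq> []\<close> have "n \<ge> 1" by (cases n) simp_all
    with k show ?thesis by blast
  qed
  with maximal_wordI[OF v maximal_wpow] lyndon show ?thesis by (simp add: complete_optimal_def)
qed

lemma lyndon_AB: "lyndon [GA, GB]"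
  and lyndon_ABB: "lyndon [GA, GB, GB]"
proof -
  have lex_less_Cons: "lex_less (GA # u) (GB # v)" for u v
    unfolding lex_less_def by (metis append_Cons append_Nil)
  show "lyndon [GA, GB]" "lyndon [GA, GB, GB]"
    by (auto simp: lyndon_def less_Suc_eq numeral_2_eq_2 lex_less_Cons)
qed

lemma complete_optimal_AB:
  fixes A B :: imat
  defines "x \<equiv> trace A" and "y \<equiv> trace B" and "z \<equiv> trace (A ** B)"
  assumes "positive_pair (real_matrix A) (real_matrix B)" and "x < y"
    and gap: "0 \<le> trace_gap x y z"
  shows "complete_optimal A B {[GA, GB]}"
proof (rule complete_optimalI[OF lyndon_AB])
  interpret positive_pair "real_matrix A" "real_matrix B" by fact
  have traces: "trace (real_matrix A) = x" "trace (real_matrix B) = y"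
    "trace (real_matrix A ** real_matrix B) = z"
    by (simp_all add: x_def y_def z_def trace_real_matrix flip: real_matrix_mult)
  have z: "2 < real_of_int z" using trace_mult_gt_2 by (simp add: traces)
  have x: "0 \<le> real_of_int x" using trace_X_ge_2 by (simp add: traces)
  have "trace_gap (real_of_int x) (real_of_int y) (real_of_int z) = real_of_int (trace_gap x y z)"
    by (simp add: trace_gap_def)
  with gap have "leading_entry y x z < sqrt (dominant_root z)"
    using x z \<open>x < y\<close> by (intro leading_entry_less_sqrt) simp_all
  moreover have "leading_entry x y z \<le> leading_entry y x z"
    using z \<open>x < y\<close> by (intro leading_entry_swap_le) simp_all
  moreover fix n w
  assume "length w = length [GA, GB] * n"
    and "weight_maximal (real_matrix A) (real_matrix B) 1 1 w"
  ultimately show "rotation_of w (wpow [GA, GB] n)"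
    using dominant_root_gt_1[OF z]
    by (intro weight_maximal_AB[of "sqrt (dominant_root z)" 1 1 w n]) (simp_all add: traces weight_1_1)
qed

lemma complete_optimal_ABB:
  fixes A B :: imat
  defines "x \<equiv> trace A" and "y \<equiv> trace B" and "z \<equiv> trace (A ** B)"
  assumes "positive_pair (real_matrix A) (real_matrix B)" and "2 * x \<le> y" "z = y\<^sup>2 - 1"
  shows "complete_optimal A B {[GA, GB, GB]}"
proof (rule complete_optimalI[OF lyndon_ABB])
  interpret positive_pair "real_matrix A" "real_matrix B" by fact
  interpret mult: positive_pair "real_matrix A ** real_matrix B" "real_matrix B"
    by (rule positive_pair_mult)
  define d :: real where "d = real_of_int y * real_of_int z - real_of_int x"
  have traces: "trace (real_matrix A) = x" "trace (real_matrix B) = y"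
    "trace (real_matrix A ** real_matrix B) = z"
    by (simp_all add: x_def y_def z_def trace_real_matrix flip: real_matrix_mult)
  then have trace_ABB: "trace (real_matrix A ** real_matrix B ** real_matrix B) = d"
    by (simp add: trace_mult_Y d_def)
  define e where "e = root 3 (dominant_root d)"
  have "2 \<le> real_of_int x" "2 * real_of_int x \<le> y" "real_of_int z = (real_of_int y)\<^sup>2 - 1"
    using trace_X_ge_2 assms(5,6) by (simp_all add: traces)
  note trace_assms = this d_def
  have "1 < dominant_root d" using dominant_root_gt_1[OF mult.trace_mult_gt_2] by (simp add: trace_ABB)
  then have e: "0 < e" "e ^ 3 = dominant_root d" by (simp_all add: e_def)
  fix n w
  assume "0 < n" "length w = length [GA, GB, GB] * n"
    and "weight_maximal (real_matrix A) (real_matrix B) 1 1 w"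
  then show "rotation_of w (wpow [GA, GB, GB] n)"
    using e dominant_root_less_growth_square[OF trace_assms e] leading_entry_A_less_growth[OF trace_assms e]
      leading_entry_B_less_growth[OF trace_assms e] leading_entry_AB_less_growth_square[OF trace_assms e]
    by (intro weight_maximal_ABB[of e 1 1 w n])
      (auto simp: traces trace_ABB weight_1_1 numeral_3_eq_3 power2_eq_square)
qed

theorem theorem7p5:
  fixes A B :: "int^2^2"
  assumes "SL2_nonneg A" and "SL2_nonneg B"
    and "A ** B \<noteq> B ** A"
    and "well_oriented A B"
    and "trace A < trace B"
    and "trace (A ** B) > trace (B ** B)"
  shows "(trace ((A ** B) ** (A ** B) ** (A ** B)) > trace ((A ** B ** B) ** (A ** B ** B))
            \<longrightarrow> complete_optimal A B {[GA, GB]})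
       \<and> (\<not> trace ((A ** B) ** (A ** B) ** (A ** B)) > trace ((A ** B ** B) ** (A ** B ** B))
            \<longrightarrow> complete_optimal A B {[GA, GB, GB]})"
proof -
  define x y z where "x = trace A" and "y = trace B" and "z = trace (A ** B)"
  have det: "det A = 1" "det B = 1" "det (A ** B) = 1" "det (A ** B ** B) = 1"
    using assms(1,2) by (simp_all add: SL2_nonneg_def det_mul)
  have xyz: "2 \<le> x" "x < y" "y\<^sup>2 - 2 < z"
    using assms SL2_nonneg_trace_ge_2[of A] trace_square[OF det(2)]
    by (simp_all add: x_def y_def z_def)
  have "x * y \<le> (y - 1) * y" using xyz by (intro mult_right_mono) auto
  also have "\<dots> \<le> z" using xyz by (simp add: algebra_simps power2_eq_square)
  finally have pair: "positive_pair (real_matrix A) (real_matrix B)"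
    using assms(1,2) by (intro positive_pair_real_matrix) (simp_all add: x_def y_def z_def)
  have "trace ((A ** B) ** (A ** B) ** (A ** B)) = z ^ 3 - 3 * z"
    unfolding z_def by (rule trace_cube[OF det(3)])
  moreover have "trace ((A ** B ** B) ** (A ** B ** B)) = (y * z - x)\<^sup>2 - 2"
    using trace_square[OF det(4)] trace_mult_square[OF det(2), of A] by (simp add: x_def y_def z_def)
  moreover have "complete_optimal A B {[GA, GB]}" if "0 \<le> trace_gap x y z"
    using complete_optimal_AB[OF pair] xyz(2) that unfolding x_def y_def z_def by blast
  moreover have "complete_optimal A B {[GA, GB, GB]}" if "trace_gap x y z < 0"
    using complete_optimal_ABB[OF pair] trace_gap_neg[OF xyz that] unfolding x_def y_def z_def by blast
  ultimately show ?thesis using trace_gap_nonneg_iff[OF xyz] by (simp add: not_le)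
qed

end
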